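(* Let $k$ be an algebraically closed field and let $K$ be a function field of transcendence degree $1$ over $k$. Suppose that $\phi\in K(x)$ is a rational function of degree at least $2$ such that there is $\sigma\in\overline K(x)$ of degree one with $\sigma\circ\phi\circ\sigma^{-1}\in k(x)$. Then for any $\beta\in\mathbb{P}^1(\overline K)$ with $\sigma(\beta)\in k$, the group $G_\infty(\phi,\beta)$ is finite.
   Context: $\phi^n$ is the $n$-th iterate. For $n\in\mathbb{N}$, $K_n(\beta)$ is the field obtained from $K(\beta)$ by adjoining all $z$ with $\phi^n(z)=\beta$, and $G_\infty(\phi,\beta)=\mathrm{Gal}(\bigcup_nK_n(\beta)/K(\beta))$. *)

theory Defs
  imports "HOL-Algebra.Algebra" "HOL-Algebra.Algebraic_Closure_Type"
begin

text \<open>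
  All fields live inside one ambient field type \<open>'a\<close>, regarded as the ring \<open>\<Omega>\<close> with carrier
  \<open>UNIV\<close>; the theorem takes \<open>\<Omega>\<close> to be an algebraic closure of \<open>K\<close>.
\<close>

abbreviation Omega :: "'a::field ring"  (\<open>\<Omega>\<close>)
  where "\<Omega> \<equiv> ring_of_type_algebra"


subsection \<open>Fields\<close>

definition function_field_1 :: "'a::field set \<Rightarrow> 'a set \<Rightarrow> bool" where
  "function_field_1 k K \<longleftrightarrow>
     subfield k \<Omega> \<and> subfield K \<Omega> \<and> k \<subseteq> K \<and>
     (\<exists>t\<in>K. ring.transcendental \<Omega> k t \<and>
            ring.finite_dimension \<Omega> (generate_field \<Omega> (insert t k)) K)"

definition galois_group :: "'a::field set \<Rightarrow> 'a set \<Rightarrow> ('a \<Rightarrow> 'a) monoid" where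
  "galois_group E F =
     (BijGroup E)\<lparr>carrier := {f \<in> Bij E. f \<in> ring_hom (\<Omega>\<lparr>carrier := E\<rparr>) (\<Omega>\<lparr>carrier := E\<rparr>)
                                       \<and> (\<forall>x\<in>F. f x = x)}\<rparr>"

lemma galois_group_is_group:
  assumes "subring E \<Omega>" and "F \<subseteq> E"
  shows "group (galois_group E F)"
proof -
  let ?R = "\<Omega>\<lparr>carrier := E\<rparr>"
  let ?A = "{f \<in> Bij E. f \<in> ring_hom ?R ?R \<and> (\<forall>x\<in>F. f x = x)}"
  have clos: "x + y \<in> E" "x * y \<in> E" if "x \<in> E" "y \<in> E" for x y
    using that subringE(6,7)[OF assms(1)] by (auto simp: ring_of_type_algebra_def)
  have one: "1 \<in> E"
    using subringE(3)[OF assms(1)] by (simp add: ring_of_type_algebra_def)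
  interpret B: group "BijGroup E"
    by (rule group_BijGroup)
  have "subgroup ?A (BijGroup E)"
  proof (rule B.subgroupI)
    show "?A \<subseteq> carrier (BijGroup E)"
      by (auto simp: BijGroup_def)
    have "(\<lambda>x\<in>E. x) \<in> ?A"
      using assms(2) clos one
      by (auto simp: id_Bij ring_hom_def ring_of_type_algebra_def)
    then show "?A \<noteq> {}" by blast
  next
    fix f assume f: "f \<in> ?A"
    then have Bij: "f \<in> Bij E" by simp
    then have im: "f ` E = E" and inj: "inj_on f E"
      by (auto simp: Bij_def bij_betw_def)
    have hom: "f (x + y) = f x + f y" "f (x * y) = f x * f y" if "x \<in> E" "y \<in> E" for x y
      using f that by (auto simp: ring_hom_def ring_of_type_algebra_def)
    have f1: "f 1 = 1"
      using f by (auto simp: ring_hom_def ring_of_type_algebra_def)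
    have "inv_into E f (x + y) = inv_into E f x + inv_into E f y"
         "inv_into E f (x * y) = inv_into E f x * inv_into E f y" if "x \<in> E" "y \<in> E" for x y
      using that clos hom Bij by (auto intro!: Bij_inv_into_lemma[where S = E])
    moreover have "inv_into E f 1 = 1"
      using inv_into_f_f[OF inj one] f1 by simp
    moreover have "inv_into E f x = x" if "x \<in> F" for x
    proof -
      have "x \<in> E" "f x = x"
        using f that assms(2) by auto
      then show ?thesis
        using inv_into_f_f[OF inj, of x] by simp
    qed
    ultimately show "inv\<^bsub>BijGroup E\<^esub> f \<in> ?A"
      using Bij assms(2) clos one
      by (auto simp: inv_BijGroup restrict_inv_into_Bij ring_hom_def ring_of_type_algebra_def
          Bij_inv_into_mem)
  next
    fix f g assume "f \<in> ?A" "g \<in> ?A"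
    then show "f \<otimes>\<^bsub>BijGroup E\<^esub> g \<in> ?A"
      using assms(2) clos one
      by (auto simp: BijGroup_def compose_Bij[unfolded compose_def] ring_hom_def ring_of_type_algebra_def compose_def
          Pi_iff subset_iff)
  qed
  from B.subgroup_imp_group[OF this] show ?thesis
    by (simp add: galois_group_def)
qed


subsection \<open>Rational functions\<close>

definition ratfuns :: "'a::field set \<Rightarrow> 'a poly fract set" where
  "ratfuns F = {Fraction_Field.Fract p q | p q.
     q \<noteq> 0 \<and> set (Polynomial.coeffs p) \<subseteq> F \<and> set (Polynomial.coeffs q) \<subseteq> F}"

definition is_lowest_terms :: "'a::field poly fract \<Rightarrow> 'a poly \<times> 'a poly \<Rightarrow> bool" where
  "is_lowest_terms f = (\<lambda>(p, q).
     f = Fraction_Field.Fract p q \<and> Polynomial.lead_coeff q = 1 \<and> Rings.coprime p q)"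

definition lowest_terms :: "'a::field poly fract \<Rightarrow> 'a poly \<times> 'a poly" where
  "lowest_terms f = (THE pq. is_lowest_terms f pq)"

definition rat_num :: "'a::field poly fract \<Rightarrow> 'a poly" where
  "rat_num f = fst (lowest_terms f)"

definition rat_den :: "'a::field poly fract \<Rightarrow> 'a poly" where
  "rat_den f = snd (lowest_terms f)"

lemma ex1_lowest_terms: "\<exists>!pq. is_lowest_terms f pq"
proof -
  define R where "R = (\<lambda>(p, q). q \<noteq> 0 \<and> f = Fraction_Field.Fract p q)"
  have "\<exists>pq. R pq"
    by (cases f) (auto simp: R_def)
  then obtain p0 q0 where R0: "R (p0, q0)"
    and min: "\<And>p q. R (p, q) \<Longrightarrow> Polynomial.degree q0 \<le> Polynomial.degree q"
    by (metis (mono_tags, lifting) ex_has_least_nat[of R _ "\<lambda>pq. Polynomial.degree (snd pq)"]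
        prod.collapse snd_conv)
  have q0: "q0 \<noteq> 0" and f0: "f = Fraction_Field.Fract p0 q0"
    using R0 by (auto simp: R_def)
  have mult: "\<exists>a. p = a * p0 \<and> q = a * q0" if "R (p, q)" for p q
  proof -
    have q: "q \<noteq> 0" and f: "f = Fraction_Field.Fract p q"
      using that by (auto simp: R_def)
    have cross: "p * q0 = p0 * q"
      using f f0 q q0 by (simp add: eq_fract)
    define a r where "a = q div q0" and "r = q mod q0"
    have qa: "q = a * q0 + r"
      by (simp add: a_def r_def)
    have cross': "(p - a * p0) * q0 = p0 * r"
      using cross by (simp add: qa algebra_simps)
    have "r = 0"
    proof (rule ccontr)
      assume "r \<noteq> 0"
      then have "R (p - a * p0, r)"
        using cross' q0 by (simp add: R_def f0 eq_fract)
      from min[OF this] show False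
        using degree_mod_less[of q0 q] q0 \<open>r \<noteq> 0\<close> by (simp add: r_def)
    qed
    with cross' q0 qa show ?thesis
      by (intro exI[of _ a]) simp
  qed
  have cop: "Rings.coprime p0 q0"
  proof (rule coprimeI)
    fix d assume "d dvd p0" "d dvd q0"
    then obtain p1 q1 where d: "p0 = d * p1" "q0 = d * q1"
      by (auto elim!: dvdE)
    then have "d \<noteq> 0" "q1 \<noteq> 0"
      using q0 by auto
    have "R (p1, q1)"
      using \<open>q1 \<noteq> 0\<close> q0 by (simp add: R_def f0 eq_fract d)
    from min[OF this] have "Polynomial.degree d = 0"
      using d \<open>d \<noteq> 0\<close> \<open>q1 \<noteq> 0\<close> by (simp add: degree_mult_eq)
    then show "is_unit d"
      using \<open>d \<noteq> 0\<close> by (simp add: is_unit_iff_degree)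
  qed
  define c where "c = inverse (Polynomial.lead_coeff q0)"
  have c: "c \<noteq> 0"
    using q0 by (simp add: c_def)
  have "Rings.coprime (Polynomial.smult c p0) (Polynomial.smult c q0)"
    using cop c by (auto simp: coprime_def dvd_smult_iff)
  then have "is_lowest_terms f ([:c:] * p0, [:c:] * q0)"
    using c q0
    by (auto simp: is_lowest_terms_def f0 eq_fract c_def)
  moreover have "pq = ([:c:] * p0, [:c:] * q0)" if "is_lowest_terms f pq" for pq
  proof -
    obtain p q where pq: "pq = (p, q)" by fastforce
    have *: "f = Fraction_Field.Fract p q" "Polynomial.lead_coeff q = 1" "Rings.coprime p q"
      using that by (auto simp: is_lowest_terms_def pq)
    then have "R (p, q)" by (auto simp: R_def)
    from mult[OF this] obtain a where a: "p = a * p0" "q = a * q0" by blast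
    with * have "is_unit a"
      by (metis coprime_common_divisor dvd_triv_left)
    then obtain b where b: "a = [:b:]"
      by (auto simp: is_unit_poly_iff)
    have "b * Polynomial.lead_coeff q0 = 1"
      using * a b q0 by (auto split: if_splits)
    then have "b = c"
      by (simp add: c_def inverse_unique mult.commute)
    then show ?thesis
      by (simp add: pq a b)
  qed
  ultimately show ?thesis by blast
qed

definition rat_degree :: "'a::field poly fract \<Rightarrow> nat" where
  "rat_degree f = max (Polynomial.degree (rat_num f)) (Polynomial.degree (rat_den f))"

definition rat_X :: "'a::field poly fract" where
  "rat_X = to_fract [:0, 1:]"

definition poly_at :: "'a::field poly \<Rightarrow> 'a poly fract \<Rightarrow> 'a poly fract" where
  "poly_at p g = poly (map_poly (\<lambda>c. to_fract [:c:]) p) g"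

definition rat_compose :: "'a::field poly fract \<Rightarrow> 'a poly fract \<Rightarrow> 'a poly fract"
  (infixl \<open>\<circ>\<^sub>r\<close> 55) where
  "f \<circ>\<^sub>r g = poly_at (rat_num f) g / poly_at (rat_den f) g"

definition rat_inv :: "'a::field poly fract \<Rightarrow> 'a poly fract" where
  "rat_inv f = (THE g. f \<circ>\<^sub>r g = rat_X \<and> g \<circ>\<^sub>r f = rat_X)"


subsection \<open>The projective line and the action of rational functions on it\<close>

datatype 'a proj_line = Fin 'a | Infty

fun rat_eval :: "'a::field poly fract \<Rightarrow> 'a proj_line \<Rightarrow> 'a proj_line" where
  "rat_eval f (Fin a) =
     (if poly (rat_den f) a = 0 then Infty
      else Fin (poly (rat_num f) a / poly (rat_den f) a))"
| "rat_eval f Infty =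
     (if Polynomial.degree (rat_num f) > Polynomial.degree (rat_den f) then Infty
      else Fin (Polynomial.coeff (rat_num f) (Polynomial.degree (rat_den f))
                / Polynomial.lead_coeff (rat_den f)))"

text \<open>
  Adjoining a set of points of the projective line: the point at infinity is rational over
  every field, so that \<open>F(\<infinity>) = F\<close>.
\<close>

definition adjoin_points :: "'a::field set \<Rightarrow> 'a proj_line set \<Rightarrow> 'a set" where
  "adjoin_points F S = generate_field \<Omega> (F \<union> {a. Fin a \<in> S})"


subsection \<open>Iterated preimages and the associated Galois group\<close>

definition preimage_field ::
  "'a::field set \<Rightarrow> 'a poly fract \<Rightarrow> 'a proj_line \<Rightarrow> nat \<Rightarrow> 'a set" where
  "preimage_field K \<phi> \<beta> n =
     adjoin_points (adjoin_points K {\<beta>}) {z. (rat_eval \<phi> ^^ n) z = \<beta>}"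

definition G_infinity ::
  "'a::field set \<Rightarrow> 'a poly fract \<Rightarrow> 'a proj_line \<Rightarrow> ('a \<Rightarrow> 'a) monoid" where
  "G_infinity K \<phi> \<beta> =
     galois_group (\<Union>n. preimage_field K \<phi> \<beta> n) (adjoin_points K {\<beta>})"

end

theory Submission
  imports Defs
begin

text \<open>
  Let \<open>\<psi> = \<sigma> \<circ> \<phi> \<circ> \<sigma>\<inverse>\<close>. If \<open>\<phi>\<^sup>n(z) = \<beta>\<close>, then \<open>\<psi>\<^sup>n(\<sigma>(z)) = \<sigma>(\<beta>) \<in> k\<close>, and since \<open>\<psi>\<close> is a nonconstant
  rational function over the algebraically closed field \<open>k\<close>, the point \<open>\<sigma>(z)\<close> is \<open>k\<close>-rational.
  Hence every iterated preimage of \<open>\<beta>\<close> is rational over the finite extension \<open>L\<close> of \<open>K\<close> generated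
  by the coefficients of \<open>\<sigma>\<close>, so the union of the preimage fields lies in \<open>L\<close>, and an
  automorphism of it over \<open>K\<close> is determined by its values on finitely many algebraic elements.
\<close>

subsection \<open>Subfields and automorphisms of the ambient field\<close>

text \<open>\<open>rat_eval\<close> reads values off the reduced monic fraction and treats
  \<infinity> by comparing degrees, whereas membership in \<open>ratfuns\<close>, composition and
  inversion yield fractions in other forms. The identity \<psi>(\<sigma>(z)) = \<sigma>(\<phi>(z)),
  formal for functions, is therefore the technical core for points. It is proved through residues in
  the local ring at a point, where common factors cancel and \<infinity> is treated like any other
  point. Division by zero gives 0, so each composition must also be shown to have a nonzero
  denominator; this comes from the inner function being nonconstant. The extension L is finite
  because the ambient field is algebraic over K, whatever the coefficients of \<sigma> are. The
  union of the preimage fields enters the final count only as a ring between K and L, and the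
  automorphisms fixing K(\<beta>) are counted among those fixing K.\<close>

lemma Omega_simps [simp]:
  "carrier (\<Omega> :: 'a::field ring) = UNIV"
  "x \<otimes>\<^bsub>\<Omega>\<^esub> y = (x * y :: 'a)" "x \<oplus>\<^bsub>\<Omega>\<^esub> y = x + y"
  "\<zero>\<^bsub>\<Omega>\<^esub> = (0 :: 'a)" "\<one>\<^bsub>\<Omega>\<^esub> = (1 :: 'a)"
  by (simp_all add: ring_of_type_algebra_def)

lemma Omega_field: "field (\<Omega> :: 'a::field ring)"
  by (rule field_from_type_algebra)

interpretation Omega: Ring.domain "\<Omega> :: 'a::field ring"
  by (intro field.axioms Omega_field)

lemma Omega_pow [simp]: "x [^]\<^bsub>\<Omega>\<^esub> (n::nat) = (x ^ n :: 'a::field)"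
  by (induction n) (auto simp: mult.commute)

lemma Omega_a_inv [simp]: "\<ominus>\<^bsub>\<Omega>\<^esub> x = (- x :: 'a::field)"
  by (rule Omega.minus_equality) auto

lemma Omega_inv [simp]: "x \<noteq> 0 \<Longrightarrow> inv\<^bsub>\<Omega>\<^esub> x = (inverse x :: 'a::field)"
  by (rule Omega.comm_inv_char) auto

text \<open>The two polynomial representations run in opposite directions: \<open>Omega.eval\<close>
  takes lists headed by the leading coefficient, \<open>Poly\<close> lists headed by the constant
  one. The reversal is the dictionary for the transfers below.\<close>

lemma Omega_eval: "Omega.eval p x = poly (Poly (rev p)) (x :: 'a::field)"
  by (induction p) (auto simp: Poly_append poly_monom)

lemma subfield_closed:
  fixes F :: "'a::field set"
  assumes "subfield F \<Omega>"
  shows "0 \<in> F" "1 \<in> F"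
    and "x \<in> F \<Longrightarrow> y \<in> F \<Longrightarrow> x + y \<in> F"
    and "x \<in> F \<Longrightarrow> y \<in> F \<Longrightarrow> x * y \<in> F"
    and "x \<in> F \<Longrightarrow> - x \<in> F"
    and "x \<in> F \<Longrightarrow> y \<in> F \<Longrightarrow> x - y \<in> F"
    and "x \<in> F \<Longrightarrow> y \<in> F \<Longrightarrow> x / y \<in> F"
proof -
  note sub = subringE[OF subfieldE(1)[OF assms], simplified]
  show "0 \<in> F" "1 \<in> F" using sub by auto
  show add: "x \<in> F \<Longrightarrow> y \<in> F \<Longrightarrow> x + y \<in> F" for x y using sub by auto
  show mult: "x \<in> F \<Longrightarrow> y \<in> F \<Longrightarrow> x * y \<in> F" for x y using sub by auto
  show uminus: "x \<in> F \<Longrightarrow> - x \<in> F" for x using sub by auto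
  show "x \<in> F \<Longrightarrow> y \<in> F \<Longrightarrow> x - y \<in> F"
    using add[OF _ uminus, of x y] by simp
  show "x \<in> F \<Longrightarrow> y \<in> F \<Longrightarrow> x / y \<in> F"
  \<comment> \<open>Division is total: for \<open>y = 0\<close> the quotient is 0, which lies in
    \<open>F\<close>.\<close>
  proof (cases "y = 0")
    case False
    assume "x \<in> F" "y \<in> F"
    then show ?thesis
      using mult[of x "inverse y"] Omega.subfield_m_inv(1)[OF assms, of y] False
      by (simp add: field_simps)
  qed (use sub in simp)
qed

section \<open>Polynomials over a subfield and their roots\<close>

definition poly_over :: "'a::field set \<Rightarrow> 'a poly \<Rightarrow> bool" where
  "poly_over F p \<longleftrightarrow> set (Polynomial.coeffs p) \<subseteq> F"

lemma poly_over_pCons_iff: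
  "0 \<in> F \<Longrightarrow> poly_over F (pCons c p) \<longleftrightarrow> c \<in> F \<and> poly_over F p"
  by (auto simp: poly_over_def cCons_def)

lemma poly_over_0 [simp]: "poly_over F 0"
  by (simp add: poly_over_def)

lemma poly_over_coeff: "0 \<in> F \<Longrightarrow> poly_over F p \<longleftrightarrow> (\<forall>i. Polynomial.coeff p i \<in> F)"
  unfolding poly_over_def
  by (induction p) (auto simp: coeff_pCons cCons_def split: nat.splits)

lemma poly_over_poly:
  assumes F: "subfield F \<Omega>" and "poly_over F p" "x \<in> F"
  shows "poly p x \<in> F"
  using assms(2) subfield_closed[OF F] \<open>x \<in> F\<close>
  by (induction p) (auto simp: poly_over_pCons_iff)

text \<open>By Horner's scheme each coefficient of the quotient by X - x is the value at
  \<open>x\<close> of a tail of \<open>p\<close>, so closure under evaluation suffices.\<close>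

lemma poly_over_synthetic_div:
  assumes F: "subfield F \<Omega>" and "poly_over F p" "x \<in> F"
  shows "poly_over F (synthetic_div p x)"
  using assms(2) subfield_closed[OF F] \<open>x \<in> F\<close>
  by (induction p) (auto simp: poly_over_pCons_iff intro: poly_over_poly[OF F])

lemma synthetic_div_factor:
  assumes "poly p (a :: 'a::field) = 0"
  shows "p = [:-a, 1:] * synthetic_div p a"
  using synthetic_div_correct'[of a p] assms by simp

lemma algebraically_closed_root:
  fixes F :: "'a::field set"
  assumes F: "subfield F \<Omega>" and closed: "algebraically_closed (\<Omega>\<lparr>carrier := F\<rparr>)"
    and p: "poly_over F p" "Polynomial.degree p > 0"
  shows "\<exists>x\<in>F. poly p x = 0"
proof -
  interpret S: algebraically_closed "\<Omega>\<lparr>carrier := F\<rparr>" by (rule closed)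
  define P where "P = rev (Polynomial.coeffs p)"
  have p0: "p \<noteq> 0" using p by auto
  have len: "length P = Suc (Polynomial.degree p)"
    using p0 by (simp add: P_def length_coeffs_degree)
  have "hd P \<noteq> 0"
    using p0 by (simp add: P_def hd_rev last_coeffs_eq_coeff_degree)
  moreover have "set P \<subseteq> F"
    using p by (simp add: P_def poly_over_def)
  ultimately have car: "P \<in> carrier (poly_ring (\<Omega>\<lparr>carrier := F\<rparr>))"
    by (auto simp: univ_poly_def polynomial_def)
  \<comment> \<open>Over an algebraically closed field \<open>P\<close> splits, so its multiset of
    roots has as many elements as the degree, in particular at least one.\<close>
  have "size (S.roots P) = Polynomial.degree p"
    using S.roots_over_carrier[OF car] len by (simp add: S.splitted_def)
  then obtain x where "x \<in># S.roots P"
    using p(2) by (metis multiset_nonemptyE size_empty less_irrefl)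
  then have "S.is_root P x"
    using S.roots_mem_iff_is_root[OF car] by blast
  then have "x \<in> F" "S.eval P x = 0"
    by (auto simp: S.is_root_def)
  moreover have "S.eval P x = poly p x"
    using Omega.eval_consistent[OF subfieldE(1)[OF F]] by (simp add: Omega_eval P_def)
  ultimately show ?thesis by auto
qed

text \<open>A root in \<open>F\<close> splits off a linear factor and leaves a quotient over
  \<open>F\<close> of smaller degree; a root \<open>y\<close> in the ambient field is either that
  root or a root of the quotient.\<close>

lemma algebraically_closed_all_roots:
  fixes F :: "'a::field set"
  assumes F: "subfield F \<Omega>" and closed: "algebraically_closed (\<Omega>\<lparr>carrier := F\<rparr>)"
    and "poly_over F p" "p \<noteq> 0" "poly p y = 0"
  shows "y \<in> F"
  using assms(3-5)
proof (induction "Polynomial.degree p" arbitrary: p rule: less_induct)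
  case less
  have "Polynomial.degree p > 0"
    using less.prems by (metis degree_eq_zeroE gr0I poly_0 poly_pCons mult_zero_right add.right_neutral pCons_0_0)
  then obtain x where x: "x \<in> F" "poly p x = 0"
    using algebraically_closed_root[OF F closed] less.prems by blast
  let ?q = "synthetic_div p x"
  have pq: "p = [:-x, 1:] * ?q"
    by (rule synthetic_div_factor[OF x(2)])
  have "poly ([:-x, 1:] * ?q) y = (y - x) * poly ?q y"
    by (simp add: algebra_simps)
  then have "poly p y = (y - x) * poly ?q y"
    unfolding pq[symmetric] .
  then consider "y = x" | "poly ?q y = 0" using less.prems by auto
  then show ?case
  proof cases
    case 2
    have "?q \<noteq> 0" using pq less.prems by auto
    moreover have "Polynomial.degree ?q < Polynomial.degree p"
      using \<open>Polynomial.degree p > 0\<close> by (simp add: degree_synthetic_div)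
    ultimately show ?thesis
      using less.hyps[of ?q] 2 less.prems poly_over_synthetic_div[OF F _ x(1)] by blast
  qed (use x in simp)
qed

lemma algebraic_imp_poly_root:
  fixes F :: "'a::field set"
  assumes F: "subfield F \<Omega>" and "(Omega.algebraic over F) x"
  shows "\<exists>p. p \<noteq> 0 \<and> poly_over F p \<and> poly p x = 0"
proof -
  obtain P where P: "P \<in> carrier (F[X]\<^bsub>\<Omega>\<^esub>)" "P \<noteq> []" "Omega.eval P x = 0"
    using Omega.algebraicE[OF subfieldE(1)[OF F], of x] assms by auto
  then have poly: "set P \<subseteq> F" "hd P \<noteq> 0"
    by (auto simp: univ_poly_def polynomial_def)
  \<comment> \<open>The leading coefficient \<open>hd P\<close> is nonzero, so \<open>Poly\<close>
    strips nothing from the end of the reversed list.\<close>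
  have "Polynomial.coeffs (Poly (rev P)) = rev P"
    using P poly by (cases P) simp_all
  then have "poly_over F (Poly (rev P))" "Poly (rev P) \<noteq> 0"
    using poly P by (simp_all add: poly_over_def flip: coeffs_eq_Nil)
  with P show ?thesis by (auto simp: Omega_eval)
qed

text \<open>The dimension of \<open>L\<close> bounds the length of independent lists, so a longest
  one inside \<open>E\<close> exists, and it spans \<open>E\<close> by maximality. Taking its
  entries from \<open>E\<close> rather than from \<open>L\<close> matters: automorphisms of
  \<open>E\<close> will be evaluated at them.\<close>

lemma finite_dimension_imp_subset_Span:
  fixes F :: "'a::field set"
  assumes F: "subfield F \<Omega>" and fin: "Omega.finite_dimension F L" and "E \<subseteq> L"
  shows "\<exists>Us. set Us \<subseteq> E \<and> E \<subseteq> Omega.Span F Us"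
proof -
  obtain n where n: "Omega.dimension n F L"
    using fin by auto
  define P where "P = (\<lambda>m. \<exists>Us. Omega.independent F Us \<and> set Us \<subseteq> E \<and> length Us = m)"
  have "P 0" by (auto simp: P_def)
  moreover have bound: "m \<le> n" if "P m" for m
    using that Omega.independent_length_le_dimension[OF F n] \<open>E \<subseteq> L\<close> unfolding P_def by blast
  ultimately have "P (Greatest P)" and max: "\<And>m. P m \<Longrightarrow> m \<le> Greatest P"
    by (blast intro: GreatestI_nat Greatest_le_nat)+
  then obtain Us where Us: "Omega.independent F Us" "set Us \<subseteq> E" "length Us = Greatest P"
    by (auto simp: P_def)
  have "u \<in> Omega.Span F Us" if "u \<in> E" for u
  proof (rule ccontr)
    assume "u \<notin> Omega.Span F Us"
    then have "Omega.independent F (u # Us)"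
      using Us by (intro Omega.li_Cons) auto
    then have "P (Suc (Greatest P))"
      using Us that by (subst P_def, intro exI[of _ "u # Us"]) simp
    then show False using max by force
  qed
  with Us show ?thesis by blast
qed

text \<open>Restriction to a list in \<open>E\<close> that spans \<open>E\<close> over
  \<open>F\<close> embeds the group into a finite product of root sets.\<close>

lemma finite_galois_group:
  fixes E F L :: "'a::field set"
  assumes F: "subfield F \<Omega>" and E: "subring E \<Omega>" and "F \<subseteq> E" "E \<subseteq> L"
    and fin: "Omega.finite_dimension F L"
    and L: "subring L \<Omega>"
  shows "finite (carrier (galois_group E F))"
proof -
  have alg: "(Omega.algebraic over F) x" if "x \<in> E" for x
    using Omega.finite_dimension_imp_algebraic[OF F L fin] \<open>E \<subseteq> L\<close> that by blast
  note cl = subringE(6,7)[OF E, simplified]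
  have "0 \<in> F" using subfield_closed[OF F] by auto
  define G where "G = carrier (galois_group E F)"
  obtain Us where Us: "set Us \<subseteq> E" "E \<subseteq> Omega.Span F Us"
    using finite_dimension_imp_subset_Span[OF F fin \<open>E \<subseteq> L\<close>] by blast
  have "\<exists>p. p \<noteq> 0 \<and> poly_over F p \<and> poly p u = 0" if "u \<in> E" for u
    using algebraic_imp_poly_root[OF F alg[OF that]] .
  then obtain P where P: "\<And>u. u \<in> E \<Longrightarrow> P u \<noteq> 0 \<and> poly_over F (P u) \<and> poly (P u) u = 0"
    by metis
  have add_mult: "f (x + y) = f x + f y" "f (x * y) = f x * f y"
    if "f \<in> G" "x \<in> E" "y \<in> E" for f x y
    using that by (auto simp: G_def galois_group_def ring_hom_def)
  have fixed: "f c = c" if "f \<in> G" "c \<in> F" for f c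
    using that by (auto simp: G_def galois_group_def)
  have ext: "f \<in> extensional E" if "f \<in> G" for f
    using that by (auto simp: G_def galois_group_def Bij_def)
  have G_poly: "poly p u \<in> E \<and> f (poly p u) = poly p (f u)"
    if "f \<in> G" "u \<in> E" "poly_over F p" for f u p
    using that(3)
  proof (induction p)
    case 0
    then show ?case using \<open>0 \<in> F\<close> \<open>F \<subseteq> E\<close> fixed[OF that(1)] by auto
  next
    case (pCons c p)
    then have "c \<in> F" "poly p u \<in> E" "f (poly p u) = poly p (f u)"
      by (auto simp: poly_over_pCons_iff \<open>0 \<in> F\<close>)
    moreover from this have "c \<in> E" "u * poly p u \<in> E"
      using \<open>F \<subseteq> E\<close> cl that by auto
    ultimately show ?case
      using add_mult[OF that(1)] fixed[OF that(1)] cl that(2) by simp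
  qed
  \<comment> \<open>\<open>P u\<close> has coefficients in \<open>F\<close>, which \<open>f\<close>
    fixes, so \<open>f u\<close> is again a root of \<open>P u\<close>.\<close>
  have "(\<lambda>f. restrict f (set Us)) ` G \<subseteq> (\<Pi>\<^sub>E u\<in>set Us. {x. poly (P u) x = 0})"
  proof (intro image_subsetI restrict_PiE_iff[THEN iffD2] ballI CollectI)
    fix f u assume "f \<in> G" "u \<in> set Us"
    then show "poly (P u) (f u) = 0"
      using G_poly[of f u "P u"] P[of u] Us fixed[of f 0] \<open>0 \<in> F\<close> by auto
  qed
  moreover have "finite (\<Pi>\<^sub>E u\<in>set Us. {x. poly (P u) x = 0})"
    using P Us by (intro finite_PiE) (auto intro!: poly_roots_finite)
  ultimately have "finite ((\<lambda>f. restrict f (set Us)) ` G)"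
    by (rule finite_subset)
  moreover have "inj_on (\<lambda>f. restrict f (set Us)) G"
  proof (rule inj_onI)
    fix f g assume f: "f \<in> G" and g: "g \<in> G" and eq: "restrict f (set Us) = restrict g (set Us)"
    \<comment> \<open>Automorphisms over \<open>F\<close> are \<open>F\<close>-linear, so agreement
      on \<open>Us\<close> extends to all combinations. Membership in \<open>E\<close> is carried
      along because additivity is only available there.\<close>
    have comb: "Omega.combine Ks Vs \<in> E \<and> f (Omega.combine Ks Vs) = g (Omega.combine Ks Vs)"
      if "set Ks \<subseteq> F" "set Vs \<subseteq> set Us" for Ks Vs
      using that
    proof (induction Ks Vs rule: Omega.combine.induct)
      case (1 c Ks u Vs)
      have "f u = g u" using eq 1(3) by (metis list.set_intros(1) restrict_apply' subsetD)
      moreover have "c \<in> F" "c \<in> E" "u \<in> E" using 1 \<open>F \<subseteq> E\<close> Us by auto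
      ultimately show ?case
        using 1 cl add_mult[OF f] add_mult[OF g] fixed[OF f] fixed[OF g] by auto
    qed (use \<open>0 \<in> F\<close> \<open>F \<subseteq> E\<close> fixed[OF f] fixed[OF g] in auto)
    show "f = g"
    \<comment> \<open>Elements of \<open>Bij E\<close> are extensional, so equality on
      \<open>E\<close> is equality of functions.\<close>
    proof (rule extensionalityI[OF ext[OF f] ext[OF g]])
      fix x assume "x \<in> E"
      then obtain Ks where "set Ks \<subseteq> F" "x = Omega.combine Ks Us"
        using Us Omega.Span_eq_combine_set[OF F, of Us] by auto
      then show "f x = g x" using comb by blast
    qed
  qed
  ultimately show ?thesis unfolding G_def using finite_imageD by blast
qed

subsection \<open>Values of rational functions\<close>

text \<open>An element of least degree in the ideal generated by \<open>p\<close> and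
  \<open>q\<close> divides every member by division with remainder, hence both generators, and is
  therefore a unit.\<close>

lemma poly_bezout:
  fixes p q :: "'a::field poly"
  assumes "Rings.coprime p q"
  shows "\<exists>u v. u * p + v * q = 1"
proof -
  define I where "I = {u * p + v * q | u v. True}"
  have mult: "a * g \<in> I" if "g \<in> I" for a g
    using that unfolding I_def
    by clarify (metis (no_types) distrib_left mult.assoc)
  have diff: "g - h \<in> I" if "g \<in> I" "h \<in> I" for g h
  proof -
    from that obtain u v u' v' where "g = u * p + v * q" "h = u' * p + v' * q"
      by (auto simp: I_def)
    then have "g - h = (u - u') * p + (v - v') * q"
      by (simp add: algebra_simps)
    then show ?thesis unfolding I_def by blast
  qed
  have pI: "p \<in> I"
    unfolding I_def by (rule CollectI, rule exI[of _ 1], rule exI[of _ 0]) simp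
  have qI: "q \<in> I"
    unfolding I_def by (rule CollectI, rule exI[of _ 0], rule exI[of _ 1]) simp
  have "p \<noteq> 0 \<or> q \<noteq> 0"
    using assms by auto
  then have "\<exists>g. g \<in> I \<and> g \<noteq> 0" using pI qI by blast
  then obtain g where g: "g \<in> I" "g \<noteq> 0"
    and min: "\<And>h. h \<in> I \<Longrightarrow> h \<noteq> 0 \<Longrightarrow> Polynomial.degree g \<le> Polynomial.degree h"
    using ex_has_least_nat[of "\<lambda>g. g \<in> I \<and> g \<noteq> 0" _ Polynomial.degree] by blast
  have dvd: "g dvd h" if "h \<in> I" for h
  proof (rule ccontr)
    assume "\<not> g dvd h"
    then have "h mod g \<noteq> 0" by (simp add: dvd_eq_mod_eq_0)
    moreover have "h mod g \<in> I"
      using diff[OF that mult[OF g(1), of "h div g"]] by (simp add: minus_div_mult_eq_mod)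
    ultimately show False
      using min[of "h mod g"] degree_mod_less[of g h] g by auto
  qed
  have "is_unit g"
    using assms dvd[OF pI] dvd[OF qI] by (rule coprime_common_divisor)
  then obtain w where "1 = g * w" by (rule dvdE)
  then have "1 \<in> I" using mult[OF g(1), of w] by (simp add: mult.commute)
  then show ?thesis unfolding I_def by force
qed

section \<open>Reduced fractions and arbitrary representatives\<close>

lemma lowest_terms_works: "is_lowest_terms f (rat_num f, rat_den f)"
  using theI'[OF ex1_lowest_terms[of f]] by (simp add: rat_num_def rat_den_def lowest_terms_def)

lemma rat_den_monic [simp]: "Polynomial.coeff (rat_den f) (Polynomial.degree (rat_den f)) = 1"
  using lowest_terms_works[of f] by (simp add: is_lowest_terms_def)

lemma rat_den_nonzero [simp]: "rat_den f \<noteq> 0"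
  using rat_den_monic[of f] by force

lemma rat_num_den_quotient: "to_fract (rat_num f) / to_fract (rat_den f) = f"
  using lowest_terms_works[of f] by (simp add: is_lowest_terms_def Fract_conv_to_fract)

lemma rat_num_den_bezout: "\<exists>u v. u * rat_num f + v * rat_den f = 1"
  using lowest_terms_works[of f] by (simp add: is_lowest_terms_def poly_bezout)

lemma rat_num_den_not_both_zero: "poly (rat_den f) a = 0 \<Longrightarrow> poly (rat_num f) a \<noteq> 0"
proof
  assume *: "poly (rat_den f) a = 0" "poly (rat_num f) a = 0"
  obtain u v where "u * rat_num f + v * rat_den f = 1" using rat_num_den_bezout by blast
  then have "poly (u * rat_num f + v * rat_den f) a = poly 1 a" by simp
  with * show False by simp
qed

lemma rat_num_den_eqI:
  assumes "f = to_fract p / to_fract q" "Rings.coprime p q" "Polynomial.lead_coeff q = 1"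
  shows "rat_num f = p" "rat_den f = q"
proof -
  have "is_lowest_terms f (p, q)"
    using assms by (simp add: is_lowest_terms_def Fract_conv_to_fract)
  with lowest_terms_works[of f] have "(rat_num f, rat_den f) = (p, q)"
    using ex1_lowest_terms[of f] by blast
  then show "rat_num f = p" "rat_den f = q" by auto
qed

text \<open>This lets values and compositions be computed from any fraction representing
  \<open>f\<close>, at the price of a common factor \<open>a\<close>.\<close>

lemma quotient_eq_multiple_of_lowest_terms:
  assumes "f = to_fract p / to_fract q" "q \<noteq> 0"
  shows "\<exists>a. a \<noteq> 0 \<and> p = a * rat_num f \<and> q = a * rat_den f"
proof -
  obtain u v where uv: "u * rat_num f + v * rat_den f = 1" using rat_num_den_bezout by blast
  have "to_fract p / to_fract q = to_fract (rat_num f) / to_fract (rat_den f)"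
    using assms rat_num_den_quotient by metis
  then have "to_fract (p * rat_den f) = to_fract (rat_num f * q)"
    using assms(2) by (simp add: frac_eq_eq)
  then have cross: "p * rat_den f = rat_num f * q"
    by (simp only: to_fract_eq_iff)
  \<comment> \<open>If \<open>p = a * rat_num f\<close> and \<open>q = a * rat_den f\<close>, the
    Bezout relation forces this value of \<open>a\<close>.\<close>
  define a where "a = u * p + v * q"
  have "q = q * (u * rat_num f + v * rat_den f)" using uv by simp
  also have "\<dots> = u * (rat_num f * q) + v * q * rat_den f" by (simp add: algebra_simps)
  also have "\<dots> = a * rat_den f"
    unfolding cross[symmetric] a_def by (simp add: algebra_simps)
  finally have q: "q = a * rat_den f" .
  have "p * rat_den f = (a * rat_num f) * rat_den f"
    unfolding cross by (subst q) (simp add: algebra_simps)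
  then have "p = a * rat_num f" by simp
  moreover have "a \<noteq> 0" using q assms(2) by auto
  ultimately show ?thesis using q by blast
qed

section \<open>Constants and substitution into polynomials\<close>

abbreviation rat_const :: "'a::field \<Rightarrow> 'a poly fract" where
  "rat_const c \<equiv> to_fract [:c:]"

lemma rat_const_simps:
  "rat_const (0 :: 'a::field) = 0" "rat_const (1 :: 'a) = 1"
  "rat_const (a + b) = rat_const a + rat_const b"
  "rat_const (a - b) = rat_const a - rat_const b"
  "rat_const (a * b) = rat_const a * rat_const b"
  "rat_const (- a) = - rat_const a"
  "rat_const a = rat_const b \<longleftrightarrow> a = b"
  "rat_const a = 0 \<longleftrightarrow> a = 0"
  by (simp_all flip: to_fract_add to_fract_diff to_fract_mult to_fract_uminus one_pCons)

lemma rat_const_divide: "rat_const (a / b) = rat_const a / rat_const (b :: 'a::field)"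
  by (cases "b = 0") (simp_all add: nonzero_eq_divide_eq flip: to_fract_mult)

lemma rat_degree_const [simp]: "rat_degree (rat_const c) = 0"
proof -
  have "rat_const c = to_fract [:c:] / to_fract 1" by simp
  from rat_num_den_eqI[OF this] show ?thesis by (simp add: rat_degree_def)
qed

lemma poly_at_pCons [simp]: "poly_at (pCons c p) g = rat_const c + g * poly_at p g"
  by (simp add: poly_at_def map_poly_pCons)

lemma poly_at_0 [simp]: "poly_at 0 g = 0"
  by (simp add: poly_at_def)

lemma poly_at_add: "poly_at (p + q) g = poly_at p g + poly_at q g"
  by (induction p q rule: poly_induct2) (simp_all add: rat_const_simps algebra_simps)

lemma poly_at_smult: "poly_at (Polynomial.smult c p) g = rat_const c * poly_at p g"
  by (induction p) (simp_all add: rat_const_simps algebra_simps)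

lemma poly_at_mult: "poly_at (p * q) g = poly_at p g * poly_at q g"
  by (induction p) (simp_all add: rat_const_simps poly_at_add poly_at_smult algebra_simps)

text \<open>The common factor contributes \<open>poly_at a g\<close> to both parts; it divides the
  nonzero \<open>poly_at q g\<close>, so it can be cancelled.\<close>

lemma rat_compose_quotient:
  assumes "f = to_fract p / to_fract q" "q \<noteq> 0" "poly_at q g \<noteq> 0"
  shows "f \<circ>\<^sub>r g = poly_at p g / poly_at q g"
proof -
  obtain a where "a \<noteq> 0" "p = a * rat_num f" "q = a * rat_den f"
    using quotient_eq_multiple_of_lowest_terms[OF assms(1,2)] by blast
  with assms(3) show ?thesis
    by (simp add: rat_compose_def poly_at_mult)
qed

text \<open>The maximal ideal of the local ring of the projective line at a point.\<close>

definition vanishing_at :: "'a::field proj_line \<Rightarrow> 'a poly fract set" where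
  "vanishing_at z = {to_fract r / to_fract q | r q. q \<noteq> 0 \<and>
     (case z of Fin a \<Rightarrow> poly r a = 0 \<and> poly q a \<noteq> 0
              | Infty \<Rightarrow> r = 0 \<or> Polynomial.degree r < Polynomial.degree q)}"

lemma vanishing_atI:
  assumes "q \<noteq> 0" "f = to_fract r / to_fract q"
    and "case z of Fin a \<Rightarrow> poly r a = 0 \<and> poly q a \<noteq> 0
         | Infty \<Rightarrow> r = 0 \<or> Polynomial.degree r < Polynomial.degree q"
  shows "f \<in> vanishing_at z"
  using assms unfolding vanishing_at_def by blast

lemma vanishing_atE:
  assumes "f \<in> vanishing_at z"
  obtains r q where "f = to_fract r / to_fract q" "q \<noteq> 0"
    and "case z of Fin a \<Rightarrow> poly r a = 0 \<and> poly q a \<noteq> 0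
         | Infty \<Rightarrow> r = 0 \<or> Polynomial.degree r < Polynomial.degree q"
  using assms unfolding vanishing_at_def by blast

text \<open>Says that \<open>f\<close> is regular at \<open>z\<close> with residue \<open>v\<close>.
  Formulated as a congruence modulo the maximal ideal, it obeys the same algebra at finite points
  and at \<infinity>.\<close>

definition has_value :: "'a::field proj_line \<Rightarrow> 'a poly fract \<Rightarrow> 'a \<Rightarrow> bool" where
  "has_value z f v \<longleftrightarrow> f - rat_const v \<in> vanishing_at z"

text \<open>The zero polynomial has degree 0, so a vanishing numerator must be a separate
  alternative: over a constant denominator no strict inequality would hold.\<close>

lemma degree_mult_less:
  fixes r q q' :: "'a::field poly"
  assumes "r = 0 \<or> Polynomial.degree r < Polynomial.degree q" "q \<noteq> 0" "q' \<noteq> 0"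
    and "Polynomial.degree r' \<le> Polynomial.degree q'"
  shows "r * r' = 0 \<or> Polynomial.degree (r * r') < Polynomial.degree (q * q')"
  using assms by (cases "r = 0 \<or> r' = 0") (auto simp: degree_mult_eq)

lemma vanishing_at_add:
  assumes "f \<in> vanishing_at z" "g \<in> vanishing_at z"
  shows "f + g \<in> vanishing_at z"
proof -
  obtain r q where f: "f = to_fract r / to_fract q" "q \<noteq> 0"
    and f': "case z of Fin a \<Rightarrow> poly r a = 0 \<and> poly q a \<noteq> 0
              | Infty \<Rightarrow> r = 0 \<or> Polynomial.degree r < Polynomial.degree q"
    using assms(1) by (rule vanishing_atE)
  obtain s t where g: "g = to_fract s / to_fract t" "t \<noteq> 0"
    and g': "case z of Fin a \<Rightarrow> poly s a = 0 \<and> poly t a \<noteq> 0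
              | Infty \<Rightarrow> s = 0 \<or> Polynomial.degree s < Polynomial.degree t"
    using assms(2) by (rule vanishing_atE)
  have "f + g = to_fract (r * t + s * q) / to_fract (q * t)"
    using f g by (simp add: field_simps)
  moreover have "case z of Fin a \<Rightarrow> poly (r * t + s * q) a = 0 \<and> poly (q * t) a \<noteq> 0
              | Infty \<Rightarrow> r * t + s * q = 0 \<or> Polynomial.degree (r * t + s * q) < Polynomial.degree (q * t)"
  proof (cases z)
    case Infty
    have 1: "r * t = 0 \<or> Polynomial.degree (r * t) < Polynomial.degree (q * t)"
      using f' Infty f g by (intro degree_mult_less) auto
    have 2: "s * q = 0 \<or> Polynomial.degree (s * q) < Polynomial.degree (q * t)"
      using degree_mult_less[of s t q q] g' Infty f g by (simp add: mult.commute)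
    show ?thesis
      using 1 2 degree_add_less[of "r * t" "Polynomial.degree (q * t)" "s * q"] Infty by auto
  qed (use f' g' in auto)
  ultimately show ?thesis
    using f(2) g(2) by (intro vanishing_atI[of "q * t"]) auto
qed

lemma vanishing_at_mult_const:
  assumes "f \<in> vanishing_at z"
  shows "rat_const c * f \<in> vanishing_at z"
proof -
  obtain r q where f: "f = to_fract r / to_fract q" "q \<noteq> 0"
    and f': "case z of Fin a \<Rightarrow> poly r a = 0 \<and> poly q a \<noteq> 0
              | Infty \<Rightarrow> r = 0 \<or> Polynomial.degree r < Polynomial.degree q"
    using assms(1) by (rule vanishing_atE)
  have "rat_const c * f = to_fract ([:c:] * r) / to_fract q"
    unfolding to_fract_mult f by simp
  moreover have "case z of Fin a \<Rightarrow> poly ([:c:] * r) a = 0 \<and> poly q a \<noteq> 0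
              | Infty \<Rightarrow> [:c:] * r = 0 \<or> Polynomial.degree ([:c:] * r) < Polynomial.degree q"
    using f' by (cases z) auto
  ultimately show ?thesis
    using f(2) unfolding vanishing_at_def by blast
qed

lemma vanishing_at_mult:
  assumes "f \<in> vanishing_at z" "g \<in> vanishing_at z"
  shows "f * g \<in> vanishing_at z"
proof -
  obtain r q where f: "f = to_fract r / to_fract q" "q \<noteq> 0"
    and f': "case z of Fin a \<Rightarrow> poly r a = 0 \<and> poly q a \<noteq> 0
              | Infty \<Rightarrow> r = 0 \<or> Polynomial.degree r < Polynomial.degree q"
    using assms(1) by (rule vanishing_atE)
  obtain s t where g: "g = to_fract s / to_fract t" "t \<noteq> 0"
    and g': "case z of Fin a \<Rightarrow> poly s a = 0 \<and> poly t a \<noteq> 0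
              | Infty \<Rightarrow> s = 0 \<or> Polynomial.degree s < Polynomial.degree t"
    using assms(2) by (rule vanishing_atE)
  have "f * g = to_fract (r * s) / to_fract (q * t)"
    using f g by simp
  moreover have "case z of Fin a \<Rightarrow> poly (r * s) a = 0 \<and> poly (q * t) a \<noteq> 0
              | Infty \<Rightarrow> r * s = 0 \<or> Polynomial.degree (r * s) < Polynomial.degree (q * t)"
  proof (cases z)
    case Infty
    then show ?thesis
      using f' g' f g degree_mult_less[of r q t s] by auto
  qed (use f' g' in auto)
  ultimately show ?thesis
    using f(2) g(2) by (intro vanishing_atI[of "q * t"]) auto
qed

lemma zero_vanishing_at: "0 \<in> vanishing_at z"
  unfolding vanishing_at_def
  by (rule CollectI, rule exI[of _ 0], rule exI[of _ 1]) (auto split: proj_line.split)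

lemma has_value_const: "has_value z (rat_const c) c"
  by (simp add: has_value_def zero_vanishing_at)

lemma has_value_add:
  assumes "has_value z f v" "has_value z g w"
  shows "has_value z (f + g) (v + w)"
proof -
  have "f + g - rat_const (v + w) = (f - rat_const v) + (g - rat_const w)"
    by (simp add: rat_const_simps)
  with assms show ?thesis by (simp only: has_value_def vanishing_at_add)
qed

lemma has_value_mult:
  assumes "has_value z f v" "has_value z g w"
  shows "has_value z (f * g) (v * w)"
proof -
  define m n where "m = f - rat_const v" and "n = g - rat_const w"
  have mn: "m \<in> vanishing_at z" "n \<in> vanishing_at z"
    using assms by (simp_all add: has_value_def m_def n_def)
  \<comment> \<open>Expansion of (v + m)(w + n) - vw.\<close>
  have "f * g - rat_const (v * w) = rat_const v * n + rat_const w * m + m * n"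
    by (simp add: rat_const_simps m_def n_def algebra_simps)
  then show ?thesis
    using mn by (simp only: has_value_def vanishing_at_add vanishing_at_mult vanishing_at_mult_const)
qed

lemma has_value_power: "has_value z f v \<Longrightarrow> has_value z (f ^ n) (v ^ n)"
  by (induction n) (use has_value_const[of z 1] in \<open>auto simp: rat_const_simps intro: has_value_mult\<close>)

text \<open>Writing f = v + r/q = s/q gives 1/f - 1/v = -(1/v)(r/s). What remains is that r/s still
  vanishes at \<open>z\<close>, that is, that \<open>s\<close> can replace \<open>q\<close> as
  denominator.\<close>

lemma has_value_inverse:
  assumes "has_value z f v" "v \<noteq> 0"
  shows "has_value z (inverse f) (inverse v)"
proof -
  obtain r q where m: "f - rat_const v = to_fract r / to_fract q" "q \<noteq> 0"
    and m': "case z of Fin a \<Rightarrow> poly r a = 0 \<and> poly q a \<noteq> 0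
              | Infty \<Rightarrow> r = 0 \<or> Polynomial.degree r < Polynomial.degree q"
    using assms(1) by (auto simp: has_value_def rat_const_simps elim: vanishing_atE)
  define s where "s = Polynomial.smult v q + r"
  have s': "s \<noteq> 0 \<and> (case z of Fin a \<Rightarrow> poly r a = 0 \<and> poly s a \<noteq> 0
              | Infty \<Rightarrow> r = 0 \<or> Polynomial.degree r < Polynomial.degree s)"
  proof (cases z)
    case (Fin a)
    then have "poly s a \<noteq> 0" using m' assms(2) by (simp add: s_def)
    then show ?thesis using m' Fin by auto
  next
    case Infty
    then have "r = 0 \<or> Polynomial.degree r < Polynomial.degree (Polynomial.smult v q)"
      using m' assms(2) by simp
    \<comment> \<open>Since \<open>v\<close> is nonzero, \<open>v\<close> times \<open>q\<close>
      keeps the degree of \<open>q\<close> and dominates \<open>r\<close>.\<close>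
    then have "Polynomial.degree s = Polynomial.degree q" "s \<noteq> 0"
      unfolding s_def using assms(2) m(2)
      by (auto simp: degree_add_eq_left)
        (metis add.inverse_inverse add_eq_0_iff degree_minus degree_smult_eq less_irrefl)
    then show ?thesis using m' Infty by auto
  qed
  have "to_fract s = rat_const v * to_fract q + to_fract r"
    unfolding s_def by (simp flip: to_fract_mult)
  then have f: "f = to_fract s / to_fract q"
    using m by (simp add: field_simps)
  have v: "rat_const v \<noteq> 0" using assms by (simp add: rat_const_simps)
  have s0: "to_fract s \<noteq> 0" using s' by simp
  have "inverse f - rat_const (inverse v) = rat_const (- inverse v) * (to_fract r / to_fract s)"
    unfolding f inverse_eq_divide[of v] rat_const_divide rat_const_simps
    using v s0 m(2) \<open>to_fract s = _\<close> by (simp add: field_simps)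
  moreover have "to_fract r / to_fract s \<in> vanishing_at z"
    using s' unfolding vanishing_at_def by blast
  ultimately show ?thesis
    by (simp only: has_value_def vanishing_at_mult_const)
qed

text \<open>The fraction witnessing the residue need not be reduced; the common factor
  \<open>a\<close> cancels from the condition at \<open>z\<close>, which then speaks of the reduced
  fraction used by \<open>rat_eval\<close>.\<close>

lemma rat_eval_FinI:
  assumes "has_value z f v"
  shows "rat_eval f z = Fin v"
proof -
  obtain r q where m: "f - rat_const v = to_fract r / to_fract q" "q \<noteq> 0"
    and m': "case z of Fin a \<Rightarrow> poly r a = 0 \<and> poly q a \<noteq> 0
              | Infty \<Rightarrow> r = 0 \<or> Polynomial.degree r < Polynomial.degree q"
    using assms(1) by (auto simp: has_value_def rat_const_simps elim: vanishing_atE)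
  define s where "s = Polynomial.smult v q + r"
  have "to_fract s = rat_const v * to_fract q + to_fract r"
    unfolding s_def by (simp flip: to_fract_mult)
  then have f: "f = to_fract s / to_fract q"
    using m by (simp add: field_simps)
  obtain a where a: "a \<noteq> 0" "s = a * rat_num f" "q = a * rat_den f"
    using quotient_eq_multiple_of_lowest_terms[OF f m(2)] by blast
  show ?thesis
  proof (cases z)
    case (Fin x)
    then have "poly s x = v * poly q x" "poly q x \<noteq> 0"
      using m' by (auto simp: s_def)
    then have "poly (rat_num f) x = v * poly (rat_den f) x" "poly (rat_den f) x \<noteq> 0"
      by (auto simp: a(2,3))
    with Fin show ?thesis by simp
  next
    case Infty
    have "r = a * (rat_num f - Polynomial.smult v (rat_den f))"
      using a by (simp add: s_def algebra_simps)
    \<comment> \<open>The degree of \<open>a\<close> occurs on both sides of the inequality between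
      \<open>r\<close> and \<open>q\<close> and cancels.\<close>
    then have *: "rat_num f - Polynomial.smult v (rat_den f) = 0
        \<or> Polynomial.degree (rat_num f - Polynomial.smult v (rat_den f)) < Polynomial.degree (rat_den f)"
      using m' a(1) Infty unfolding a(3)
      by (cases "rat_num f - Polynomial.smult v (rat_den f) = 0") (auto simp: degree_mult_eq)
    \<comment> \<open>As \<open>rat_den f\<close> is monic, this says that the coefficient read by
      \<open>rat_eval\<close> at \<infinity> is \<open>v\<close>.\<close>
    then have "Polynomial.coeff (rat_num f - Polynomial.smult v (rat_den f)) (Polynomial.degree (rat_den f)) = 0"
      using coeff_eq_0 by force
    moreover have "Polynomial.degree (rat_num f) \<le> Polynomial.degree (rat_den f)"
    proof -
      have "Polynomial.degree ((rat_num f - Polynomial.smult v (rat_den f)) + Polynomial.smult v (rat_den f))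
          \<le> Polynomial.degree (rat_den f)"
        using * by (intro degree_add_le) (auto simp: degree_smult_le)
      then show ?thesis by simp
    qed
    ultimately show ?thesis using Infty by simp
  qed
qed

text \<open>Poles are zeros of the reciprocal. The condition \<open>f \<noteq> 0\<close> excludes
  the convention \<open>inverse 0 = 0\<close>, under which the zero function would look like a
  pole.\<close>

lemma rat_eval_InftyI:
  assumes "f \<noteq> 0" "has_value z (inverse f) 0"
  shows "rat_eval f z = Infty"
proof -
  obtain r q where m: "inverse f = to_fract r / to_fract q" "q \<noteq> 0"
    and m': "case z of Fin a \<Rightarrow> poly r a = 0 \<and> poly q a \<noteq> 0
              | Infty \<Rightarrow> r = 0 \<or> Polynomial.degree r < Polynomial.degree q"
    using assms(2) by (auto simp: has_value_def rat_const_simps elim: vanishing_atE)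
  have "r \<noteq> 0" using m assms(1) by auto
  moreover have "f = to_fract q / to_fract r"
    using arg_cong[OF m(1), of inverse] by simp
  ultimately obtain a where a: "a \<noteq> 0" "q = a * rat_num f" "r = a * rat_den f"
    using quotient_eq_multiple_of_lowest_terms by blast
  show ?thesis
    using m' a m(2) by (cases z) (auto simp: degree_mult_eq)
qed

lemma has_value_of_rat_eval:
  assumes "rat_eval f z = Fin v"
  shows "has_value z f v"
proof -
  let ?r = "rat_num f - Polynomial.smult v (rat_den f)"
  have "to_fract ?r = to_fract (rat_num f) - rat_const v * to_fract (rat_den f)"
    by (simp flip: to_fract_mult)
  then have "f - rat_const v = to_fract ?r / to_fract (rat_den f)"
    by (subst rat_num_den_quotient[of f, symmetric]) (simp add: field_simps)
  moreover have "case z of Fin a \<Rightarrow> poly ?r a = 0 \<and> poly (rat_den f) a \<noteq> 0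
              | Infty \<Rightarrow> ?r = 0 \<or> Polynomial.degree ?r < Polynomial.degree (rat_den f)"
  proof (cases z)
    case Infty
    then have deg: "Polynomial.degree (rat_num f) \<le> Polynomial.degree (rat_den f)"
      and v: "v = Polynomial.coeff (rat_num f) (Polynomial.degree (rat_den f))"
      using assms by (auto split: if_splits)
    have "Polynomial.degree ?r \<le> Polynomial.degree (rat_den f)"
      using deg by (intro degree_diff_le) (auto simp: degree_smult_le)
    \<comment> \<open>Subtracting \<open>v\<close> times the monic denominator kills the top
      possible coefficient, so the degree drops strictly.\<close>
    moreover have "Polynomial.coeff ?r (Polynomial.degree (rat_den f)) = 0"
      by (simp add: v)
    ultimately have "?r = 0 \<or> Polynomial.degree ?r < Polynomial.degree (rat_den f)"
      by (metis leading_coeff_0_iff le_neq_implies_less)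
    with Infty show ?thesis by simp
  qed (use assms in \<open>auto split: if_splits\<close>)
  ultimately show ?thesis
    unfolding has_value_def vanishing_at_def by (intro CollectI exI[of _ ?r] exI[of _ "rat_den f"]) simp
qed

lemma pole_of_rat_eval:
  assumes "rat_eval f z = Infty"
  shows "f \<noteq> 0" "has_value z (inverse f) 0"
proof -
  have num: "rat_num f \<noteq> 0"
    using assms by (cases z) (auto split: if_splits dest: rat_num_den_not_both_zero)
  have f: "inverse f = to_fract (rat_den f) / to_fract (rat_num f)"
    by (subst rat_num_den_quotient[of f, symmetric]) simp
  then show "f \<noteq> 0"
    using num by auto
  have "case z of Fin a \<Rightarrow> poly (rat_den f) a = 0 \<and> poly (rat_num f) a \<noteq> 0
              | Infty \<Rightarrow> rat_den f = 0 \<or> Polynomial.degree (rat_den f) < Polynomial.degree (rat_num f)"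
    using assms by (cases z) (auto split: if_splits dest: rat_num_den_not_both_zero)
  then show "has_value z (inverse f) 0"
    unfolding has_value_def vanishing_at_def f using num
    by (intro CollectI exI[of _ "rat_den f"] exI[of _ "rat_num f"]) simp
qed

lemma has_value_poly_at:
  assumes "has_value z g v"
  shows "has_value z (poly_at p g) (poly p v)"
proof (induction p)
  case 0
  then show ?case using has_value_const[of z 0] by simp
next
  case (pCons c p)
  then show ?case
    using has_value_add[OF has_value_const has_value_mult[OF assms]] by simp
qed

text \<open>Divided by the top power of \<open>g\<close>, the substituted polynomial becomes a
  polynomial in 1/g with constant term the leading coefficient of \<open>p\<close>, and 1/g vanishes
  at \<open>z\<close>.\<close>

lemma has_value_poly_at_pole:
  assumes g: "g \<noteq> 0" "has_value z (inverse g) 0" and "p \<noteq> 0"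
  shows "has_value z (poly_at p g * inverse g ^ Polynomial.degree p) (Polynomial.lead_coeff p)"
  using assms(3)
proof (induction p)
  case (pCons c p)
  show ?case
  proof (cases "p = 0")
    case True
    then show ?thesis using has_value_const by simp
  next
    case False
    let ?n = "Polynomial.degree p"
    have "has_value z (rat_const c * inverse g ^ Suc ?n + poly_at p g * inverse g ^ ?n)
            (c * 0 ^ Suc ?n + Polynomial.lead_coeff p)"
      using False pCons g(2) by (intro has_value_add has_value_mult has_value_power has_value_const) auto
    moreover have "rat_const c * inverse g ^ Suc ?n + poly_at p g * inverse g ^ ?n
        = poly_at (pCons c p) g * inverse g ^ Suc ?n"
      using g(1) by (simp add: field_simps)
    ultimately show ?thesis using False by simp
  qed
qed simp

text \<open>Reducing the composite could involve cancellation, so its value is found through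
  residues: numerator and denominator are evaluated at a finite value of \<open>g\<close>, or
  rescaled by powers of \<open>g\<close> at a pole. The assumption makes the division in
  \<open>\<circ>\<^sub>r\<close> genuine.\<close>

lemma rat_eval_compose:
  fixes f g :: "'a::field poly fract"
  assumes nz: "poly_at (rat_den f) g \<noteq> 0"
  shows "rat_eval (f \<circ>\<^sub>r g) z = rat_eval f (rat_eval g z)"
proof (cases "rat_eval g z")
  case (Fin v)
  then have "has_value z g v" by (rule has_value_of_rat_eval)
  note num = has_value_poly_at[OF this, of "rat_num f"] and den = has_value_poly_at[OF this, of "rat_den f"]
  show ?thesis
  proof (cases "poly (rat_den f) v = 0")
    case True
    then have *: "poly (rat_num f) v \<noteq> 0" by (rule rat_num_den_not_both_zero)
    \<comment> \<open>The zero function has residue 0, and residues are unique because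
      \<open>rat_eval\<close> computes them.\<close>
    have "poly_at (rat_num f) g \<noteq> 0"
      using num * rat_eval_FinI[of z 0] has_value_const[of z 0] by (metis proj_line.inject rat_const_simps(1))
    moreover have "has_value z (inverse (f \<circ>\<^sub>r g)) 0"
      using has_value_mult[OF den has_value_inverse[OF num *]] True
      by (simp add: rat_compose_def divide_inverse mult.commute)
    ultimately have "rat_eval (f \<circ>\<^sub>r g) z = Infty"
      using nz by (intro rat_eval_InftyI) (auto simp: rat_compose_def)
    with True Fin show ?thesis by simp
  next
    case False
    have "has_value z (f \<circ>\<^sub>r g) (poly (rat_num f) v / poly (rat_den f) v)"
      using has_value_mult[OF num has_value_inverse[OF den False]]
      by (simp add: rat_compose_def divide_inverse)
    then show ?thesis using False Fin rat_eval_FinI by simp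
  qed
next
  case Infty
  then have g: "g \<noteq> 0" "has_value z (inverse g) 0" by (rule pole_of_rat_eval)+
  define m n where "m = Polynomial.degree (rat_num f)" and "n = Polynomial.degree (rat_den f)"
  define A B where "A = poly_at (rat_num f) g * inverse g ^ m" and "B = poly_at (rat_den f) g * inverse g ^ n"
  have B: "has_value z B 1"
    using has_value_poly_at_pole[OF g rat_den_nonzero[of f]] by (simp add: B_def n_def)
  have "B \<noteq> 0" using nz g by (simp add: B_def)
  show ?thesis
  proof (cases "rat_num f = 0")
    case True
    then have "has_value z (f \<circ>\<^sub>r g) 0"
      using has_value_const[of z 0] by (simp add: rat_compose_def)
    then show ?thesis using True Infty rat_eval_FinI by simp
  next
    case False
    define a where "a = Polynomial.lead_coeff (rat_num f)"
    have A: "has_value z A a" and "a \<noteq> 0"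
      using has_value_poly_at_pole[OF g False] False by (simp_all add: A_def m_def a_def)
    have "A \<noteq> 0"
      using A \<open>a \<noteq> 0\<close> rat_eval_FinI[of z 0] has_value_const[of z 0] by (metis proj_line.inject rat_const_simps(1))
    \<comment> \<open>\<open>A\<close> and \<open>B\<close> have nonzero residues, so the behaviour
      at \<open>z\<close> is decided by the power of \<open>g\<close>, that is, by the comparison of
      \<open>m\<close> and \<open>n\<close> on which \<open>rat_eval f Infty\<close>
      branches.\<close>
    have comp: "f \<circ>\<^sub>r g = A * inverse B * (g ^ m * inverse g ^ n)"
      using g(1) by (simp add: rat_compose_def A_def B_def field_simps)
    show ?thesis
    proof (cases "m \<le> n")
      case True
      have "g ^ m * inverse g ^ n = inverse g ^ (n - m)"
        using True g(1) by (simp add: power_diff field_simps)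
      then have "has_value z (f \<circ>\<^sub>r g) (a * 1 * 0 ^ (n - m))"
        unfolding comp using A g(2) has_value_inverse[OF B]
        by (auto intro!: has_value_mult has_value_power simp del: mult_1_right)
      then have "rat_eval (f \<circ>\<^sub>r g) z = Fin (a * 1 * 0 ^ (n - m))"
        by (rule rat_eval_FinI)
      \<comment> \<open>With \<open>0 ^ 0 = 1\<close> this is the leading coefficient for equal
        degrees and 0 when the numerator has smaller degree.\<close>
      also have "a * 1 * 0 ^ (n - m) = Polynomial.coeff (rat_num f) n"
        using True by (cases "m = n") (auto simp: a_def m_def power_0_left coeff_eq_0)
      finally show ?thesis using True Infty by (simp add: m_def n_def)
    next
      case False
      have "inverse (g ^ m * inverse g ^ n) = inverse g ^ (m - n)"
        using False g(1) by (simp add: power_diff field_simps)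
      then have "inverse (f \<circ>\<^sub>r g) = B * inverse A * inverse g ^ (m - n)"
        unfolding comp by (simp only: inverse_mult_distrib inverse_inverse_eq mult_ac)
      moreover have "has_value z (B * inverse A * inverse g ^ (m - n)) (1 * inverse a * 0 ^ (m - n))"
        using A B g(2) \<open>a \<noteq> 0\<close> by (intro has_value_mult has_value_power has_value_inverse)
      ultimately have "has_value z (inverse (f \<circ>\<^sub>r g)) 0"
        using False by (simp add: power_0_left)
      moreover have "f \<circ>\<^sub>r g \<noteq> 0"
        unfolding comp using \<open>A \<noteq> 0\<close> \<open>B \<noteq> 0\<close> g(1) by simp
      ultimately show ?thesis
        using False Infty rat_eval_InftyI by (simp add: m_def n_def)
    qed
  qed
qed

subsection \<open>Rationality of points\<close>

lemma algebraically_closed_Omega_root: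
  fixes p :: "'a::field poly"
  assumes closed: "algebraically_closed (\<Omega> :: 'a ring)" and "Polynomial.degree p > 0"
  shows "\<exists>x. poly p x = 0"
proof -
  have "(\<Omega> :: 'a ring)\<lparr>carrier := UNIV\<rparr> = \<Omega>"
    by (simp add: ring_of_type_algebra_def)
  moreover have "subfield UNIV (\<Omega> :: 'a ring)"
    using field.carrier_is_subfield[OF Omega_field] by simp
  ultimately show ?thesis
    using algebraically_closed_root[of UNIV p] assms by (auto simp: poly_over_def simp del: Omega_simps)
qed

text \<open>Over an algebraically closed field \<open>q\<close> splits into linear factors, and each
  g - x is nonzero because \<open>g\<close> is not constant. This supplies the side condition of
  \<open>rat_eval_compose\<close>.\<close>

lemma poly_at_nonzero:
  fixes g :: "'a::field poly fract"
  assumes closed: "algebraically_closed (\<Omega> :: 'a ring)"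
    and g: "rat_degree g > 0" and "q \<noteq> 0"
  shows "poly_at q g \<noteq> 0"
  using assms(3)
proof (induction "Polynomial.degree q" arbitrary: q rule: less_induct)
  case less
  show ?case
  proof (cases "Polynomial.degree q = 0")
    case True
    then obtain c where "q = [:c:]" by (rule degree_eq_zeroE)
    with less.prems show ?thesis by simp
  next
    case False
    then obtain x where "poly q x = 0"
      using algebraically_closed_Omega_root[OF closed] by blast
    then have q: "q = [:-x, 1:] * synthetic_div q x"
      by (rule synthetic_div_factor)
    have "poly_at [:-x, 1:] g = g - rat_const x"
      by (simp add: rat_const_simps)
    moreover have "g \<noteq> rat_const x" using g by auto
    moreover have "synthetic_div q x \<noteq> 0" using q less.prems by auto
    then have "poly_at (synthetic_div q x) g \<noteq> 0"
      using less.hyps[of "synthetic_div q x"] False by (simp add: degree_synthetic_div)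
    ultimately show ?thesis
      using poly_at_mult[of "[:-x, 1:]" "synthetic_div q x" g] unfolding q[symmetric] by simp
  qed
qed

text \<open>A root of the denominator maps to \<infinity>, a root of numerator minus
  \<open>c\<close> times denominator maps to \<open>c\<close>, coprimality excluding common zeros.
  When the relevant polynomial is constant, the point \<infinity> is the preimage.\<close>

lemma surj_rat_eval:
  fixes f :: "'a::field poly fract"
  assumes closed: "algebraically_closed (\<Omega> :: 'a ring)" and f: "rat_degree f > 0"
  shows "surj (rat_eval f)"
proof -
  note root = algebraically_closed_Omega_root[OF closed]
  have "\<exists>z. rat_eval f z = w" for w
  proof (cases w)
    case Infty
    show ?thesis
    proof (cases "Polynomial.degree (rat_den f) = 0")
      case True
      then have "rat_eval f Infty = Infty" using f by (simp add: rat_degree_def)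
      with Infty show ?thesis by blast
    next
      case False
      then obtain x where "poly (rat_den f) x = 0" using root by blast
      then have "rat_eval f (Fin x) = Infty" by simp
      with Infty show ?thesis by blast
    qed
  next
    case (Fin c)
    define p where "p = rat_num f - Polynomial.smult c (rat_den f)"
    have num: "rat_num f = p + Polynomial.smult c (rat_den f)" by (simp add: p_def)
    show ?thesis
    proof (cases "Polynomial.degree p = 0")
      case False
      then obtain x where x: "poly p x = 0" using root by blast
      then have "poly (rat_num f) x = c * poly (rat_den f) x" by (simp add: num)
      moreover from this have "poly (rat_den f) x \<noteq> 0"
        using rat_num_den_not_both_zero[of f x] by auto
      ultimately have "rat_eval f (Fin x) = Fin c" by simp
      with Fin show ?thesis by blast
    next
      case True
      \<comment> \<open>The numerator is \<open>c\<close> times the denominator plus a constant.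
        Positive degree puts that constant below the top coefficient, which is then
        \<open>c\<close>.\<close>
      have "Polynomial.degree (rat_num f) \<le> Polynomial.degree (rat_den f)"
        unfolding num using True by (intro degree_add_le) (auto simp: degree_smult_le)
      moreover from this have "Polynomial.degree (rat_den f) > 0"
        using f by (simp add: rat_degree_def)
      then have "Polynomial.coeff (rat_num f) (Polynomial.degree (rat_den f)) = c"
        unfolding num using True by (simp add: coeff_eq_0)
      ultimately have "rat_eval f Infty = Fin c" by simp
      with Fin show ?thesis by blast
    qed
  qed
  then show ?thesis by (metis surjI)
qed

section \<open>Rational points under maps defined over a subfield\<close>

definition proj_points :: "'a set \<Rightarrow> 'a proj_line set" where
  "proj_points F = insert Infty (Fin ` F)"

lemma proj_points_iff [simp]: "Infty \<in> proj_points F" "Fin a \<in> proj_points F \<longleftrightarrow> a \<in> F"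
  by (auto simp: proj_points_def)

lemma ratfuns_iff:
  "f \<in> ratfuns F \<longleftrightarrow> (\<exists>p q. f = to_fract p / to_fract q \<and> q \<noteq> 0 \<and> poly_over F p \<and> poly_over F q)"
  by (auto simp: ratfuns_def poly_over_def Fract_conv_to_fract)

text \<open>Membership in \<open>ratfuns F\<close> controls the coefficients of some fraction, not
  of the reduced one. At a finite point common zeros are divided out by synthetic division, which
  stays over \<open>F\<close>; at \<infinity> only leading coefficients enter.\<close>

lemma rat_eval_proj_points:
  fixes F :: "'a::field set"
  assumes F: "subfield F \<Omega>" and f: "f \<in> ratfuns F" and z: "z \<in> proj_points F"
  shows "rat_eval f z \<in> proj_points F"
proof (cases z)
  case (Fin x)
  have "rat_eval f (Fin x) \<in> proj_points F"
    if "f = to_fract p / to_fract q" "q \<noteq> 0" "poly_over F p" "poly_over F q" for p q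
    using that
  proof (induction "Polynomial.degree q" arbitrary: p q rule: less_induct)
    case less
    have x: "x \<in> F" using z Fin by simp
    obtain a where a: "a \<noteq> 0" "p = a * rat_num f" "q = a * rat_den f"
      using quotient_eq_multiple_of_lowest_terms[OF less.prems(1,2)] by blast
    show ?case
    proof (cases "poly a x = 0")
      case False
      then have "poly (rat_num f) x / poly (rat_den f) x = poly p x / poly q x"
        by (simp add: a)
      then show ?thesis
        using subfield_closed(7)[OF F] poly_over_poly[OF F _ x] less.prems by auto
    next
      case True
      let ?p = "synthetic_div p x" and ?q = "synthetic_div q x"
      have pq: "p = [:-x, 1:] * ?p" "q = [:-x, 1:] * ?q"
        by (rule synthetic_div_factor, simp add: a True)+
      then have "?q \<noteq> 0" using less.prems by auto
      have "to_fract [:-x, 1:] \<noteq> 0" by simp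
      then have "to_fract ([:-x, 1:] * ?p) / to_fract ([:-x, 1:] * ?q) = to_fract ?p / to_fract ?q"
        unfolding to_fract_mult by (rule mult_divide_mult_cancel_left)
      then have "f = to_fract ?p / to_fract ?q"
        using less.prems(1) unfolding pq[symmetric] by simp
      moreover have "Polynomial.degree q = Suc (Polynomial.degree ?q)"
        using degree_mult_eq[of "[:-x, 1:]" ?q] \<open>?q \<noteq> 0\<close> unfolding pq(2)[symmetric] by simp
      ultimately show ?thesis
        using less.hyps[of ?q ?p] \<open>?q \<noteq> 0\<close> less.prems poly_over_synthetic_div[OF F _ x] by simp
    qed
  qed
  with f Fin show ?thesis unfolding ratfuns_iff by blast
next
  case Infty
  obtain p q where pq: "f = to_fract p / to_fract q" "q \<noteq> 0" "poly_over F p" "poly_over F q"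
    using f by (auto simp: ratfuns_iff)
  then obtain a where a: "a \<noteq> 0" "p = a * rat_num f" "q = a * rat_den f"
    using quotient_eq_multiple_of_lowest_terms by blast
  have "Polynomial.coeff (rat_num f) (Polynomial.degree (rat_den f)) \<in> F"
    if "Polynomial.degree (rat_num f) \<le> Polynomial.degree (rat_den f)"
  proof (cases "Polynomial.degree (rat_num f) = Polynomial.degree (rat_den f)")
    case True
    \<comment> \<open>The leading coefficient of the common factor cancels in the quotient.\<close>
    have "Polynomial.lead_coeff p = Polynomial.lead_coeff a * Polynomial.lead_coeff (rat_num f)"
      "Polynomial.lead_coeff q = Polynomial.lead_coeff a"
      by (simp_all add: a(2,3) lead_coeff_mult)
    then have "Polynomial.coeff (rat_num f) (Polynomial.degree (rat_den f))
        = Polynomial.lead_coeff p / Polynomial.lead_coeff q"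
      using a(1) True by simp
    then show ?thesis
      using pq subfield_closed[OF F] by (simp add: poly_over_coeff)
  next
    case False
    then show ?thesis using that subfield_closed(1)[OF F] by (simp add: coeff_eq_0)
  qed
  with Infty show ?thesis by simp
qed

text \<open>A finite preimage is a root of \<open>q\<close> (above \<infinity>) or of
  \<open>p\<close> minus \<open>c\<close> times \<open>q\<close> (above \<open>c\<close>), both over
  \<open>k\<close>, and \<open>k\<close> contains all roots of such nonzero polynomials.
  Surjectivity is the form in which nonconstancy enters.\<close>

lemma rat_eval_proj_points_rev:
  fixes k :: "'a::field set"
  assumes k: "subfield k \<Omega>" and closed: "algebraically_closed (\<Omega>\<lparr>carrier := k\<rparr>)"
    and f: "f \<in> ratfuns k" and surj: "surj (rat_eval f)" and y: "rat_eval f y \<in> proj_points k"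
  shows "y \<in> proj_points k"
proof (cases y)
  case (Fin x)
  obtain p q where pq: "f = to_fract p / to_fract q" "q \<noteq> 0" "poly_over k p" "poly_over k q"
    using f by (auto simp: ratfuns_iff)
  then obtain a where a: "a \<noteq> 0" "p = a * rat_num f" "q = a * rat_den f"
    using quotient_eq_multiple_of_lowest_terms by blast
  have "x \<in> k"
  proof (cases "rat_eval f y")
    case Infty
    then have "poly q x = 0" using Fin by (simp add: a split: if_splits)
    then show ?thesis using algebraically_closed_all_roots[OF k closed] pq by blast
  next
    case (Fin c)
    have "poly (rat_den f) x \<noteq> 0" "poly (rat_num f) x = c * poly (rat_den f) x"
      using Fin \<open>y = Fin x\<close> by (auto split: if_splits)
    then have "poly (p - Polynomial.smult c q) x = 0" by (simp add: a)
    moreover have "poly_over k (p - Polynomial.smult c q)"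
      using pq y Fin subfield_closed[OF k] by (simp add: poly_over_coeff)
    moreover have "p - Polynomial.smult c q \<noteq> 0"
    proof
      assume "p - Polynomial.smult c q = 0"
      then have "to_fract p = to_fract ([:c:] * q)" by simp
      then have "f = rat_const c" using pq by (simp only: to_fract_mult) simp
      then have "rat_eval f z = Fin c" for z
        using rat_eval_FinI[OF has_value_const] by simp
      then show False using surj by (metis UNIV_I imageE proj_line.distinct(1))
    qed
    ultimately show ?thesis using algebraically_closed_all_roots[OF k closed] by blast
  qed
  with Fin show ?thesis by simp
qed simp

section \<open>The identity map and fractional linear maps\<close>

lemma rat_eval_X [simp]: "rat_eval rat_X z = z"
proof -
  have "rat_X = to_fract [:0, 1:] / to_fract 1" by (simp add: rat_X_def)
  from rat_num_den_eqI[OF this] have "rat_num rat_X = [:0, 1 :: 'a:]" "rat_den rat_X = (1 :: 'a poly)"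
    by simp_all
  then show ?thesis by (cases z) simp_all
qed

lemma rat_X_not_const: "rat_X \<noteq> rat_const c"
  by (simp add: rat_X_def)

lemma poly_at_const: "poly_at p (rat_const c) = rat_const (poly p c)"
  by (induction p) (simp_all add: rat_const_simps)

lemma degree_one_coeffs:
  fixes \<sigma> :: "'a::field poly fract"
  assumes "rat_degree \<sigma> = 1"
  obtains a b c d where "rat_num \<sigma> = [:b, a:]" "rat_den \<sigma> = [:d, c:]" "a * d - b * c \<noteq> 0"
proof -
  have "\<exists>u v. p = [:u, v:]" if "Polynomial.degree p \<le> 1" for p :: "'a poly"
  proof -
    obtain u r where p: "p = pCons u r" by (cases p)
    have "Polynomial.degree r = 0" using that p by (cases "r = 0") auto
    then obtain v where "r = [:v:]" by (rule degree_eq_zeroE)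
    with p show ?thesis by blast
  qed
  then obtain a b c d where *: "rat_num \<sigma> = [:b, a:]" "rat_den \<sigma> = [:d, c:]"
    using assms by (metis rat_degree_def max.cobounded1 max.cobounded2)
  \<comment> \<open>Coprimality in matrix form: for nonzero \<open>c\<close> the numerator at the
    zero -d/c of the denominator is (bc - ad)/c; for \<open>c = 0\<close> monicity gives
    \<open>d = 1\<close>.\<close>
  have "a * d - b * c \<noteq> 0"
  proof (cases "c = 0")
    case True
    then have "d = 1" using rat_den_monic[of \<sigma>] * by simp
    moreover have "a \<noteq> 0" using assms * True by (auto simp: rat_degree_def)
    ultimately show ?thesis using True by simp
  next
    case False
    then have "poly (rat_den \<sigma>) (- d / c) = 0" by (simp add: *)
    then have "poly (rat_num \<sigma>) (- d / c) \<noteq> 0" by (rule rat_num_den_not_both_zero)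
    then show ?thesis using False by (simp add: * field_simps)
  qed
  with * show ?thesis by (rule that)
qed

text \<open>The formula comes from the adjugate of the matrix with rows (a, b) and (c, d).
  Uniqueness is needed as well, since \<open>rat_inv\<close> is a definite description.\<close>

lemma rat_inv_degree_one:
  fixes \<sigma> :: "'a::field poly fract"
  assumes num: "rat_num \<sigma> = [:b, a:]" and den: "rat_den \<sigma> = [:d, c:]" and det: "a * d - b * c \<noteq> 0"
  shows "rat_inv \<sigma> = to_fract [:-b, d:] / to_fract [:a, -c:]"
    and "\<sigma> \<circ>\<^sub>r rat_inv \<sigma> = rat_X" and "rat_inv \<sigma> \<circ>\<^sub>r \<sigma> = rat_X"
proof -
  define A B C D t where "A = rat_const a" and "B = rat_const b" and "C = rat_const c"
    and "D = rat_const d" and "t = (rat_X :: 'a poly fract)"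
  have lin: "to_fract [:u, v:] = rat_const u + t * rat_const v" for u v
  proof -
    have eq: "[:u, v:] = [:u:] + [:0, 1:] * [:v:]" by simp
    show ?thesis unfolding t_def rat_X_def by (subst eq) (simp only: to_fract_add to_fract_mult)
  qed
  have det': "A * D - B * C \<noteq> 0"
  proof -
    have "rat_const (a * d - b * c) \<noteq> 0"
      using det by simp
    then show ?thesis by (simp only: rat_const_simps A_def B_def C_def D_def not_False_eq_True)
  qed
  have CX: "A - t * C \<noteq> 0"
  proof -
    have "[:a, -c:] \<noteq> 0" using det by auto
    then have "to_fract [:a, -c:] \<noteq> 0" unfolding to_fract_eq_0_iff .
    then show ?thesis by (simp add: lin rat_const_simps A_def C_def)
  qed
  have DX: "D + t * C \<noteq> 0"
  proof -
    have "[:d, c:] \<noteq> 0" using det by auto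
    then have "to_fract [:d, c:] \<noteq> 0" unfolding to_fract_eq_0_iff .
    then show ?thesis by (simp add: lin D_def C_def)
  qed
  define g where "g = to_fract [:-b, d:] / to_fract [:a, -c:]"
  have g: "g = (t * D - B) / (A - t * C)"
    by (simp add: g_def lin rat_const_simps A_def B_def C_def D_def)
  have comp: "\<sigma> \<circ>\<^sub>r h = (B + h * A) / (D + h * C)" for h
    by (simp add: rat_compose_def num den A_def B_def C_def D_def)
  have \<sigma>: "\<sigma> = (B + t * A) / (D + t * C)"
    by (subst rat_num_den_quotient[of \<sigma>, symmetric])
       (simp add: num den lin A_def B_def C_def D_def)
  have "D + g * C = (A * D - B * C) / (A - t * C)" "B + g * A = t * (A * D - B * C) / (A - t * C)"
    using CX by (simp_all add: g field_simps)
  then have 1: "\<sigma> \<circ>\<^sub>r g = t"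
    unfolding comp using det' CX by simp
  have A\<sigma>: "A - \<sigma> * C = (A * D - B * C) / (D + t * C)" "\<sigma> * D - B = t * (A * D - B * C) / (D + t * C)"
    using DX by (simp_all add: \<sigma> field_simps)
  have pA: "poly_at [:a, -c:] \<sigma> = A - \<sigma> * C" "poly_at [:-b, d:] \<sigma> = \<sigma> * D - B"
    by (simp_all add: rat_const_simps A_def B_def C_def D_def)
  have "[:a, -c:] \<noteq> 0" using det by auto
  then have 2: "g \<circ>\<^sub>r \<sigma> = t"
    using rat_compose_quotient[OF g_def, of \<sigma>] det' DX unfolding pA A\<sigma> by simp
  have uniq: "h = g" if "\<sigma> \<circ>\<^sub>r h = t" for h
  proof -
    \<comment> \<open>A zero denominator would make the composite 0 instead of X. The equation can
      then be solved linearly for \<open>h\<close>.\<close>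
    have "D + h * C \<noteq> 0"
      using that rat_X_not_const[of 0] unfolding comp t_def by (auto simp: rat_const_simps)
    then have "B + h * A = t * (D + h * C)"
      using that unfolding comp by (simp add: field_simps)
    then have "h * (A - t * C) = t * D - B" by (simp add: algebra_simps)
    then show ?thesis using nonzero_eq_divide_eq[OF CX, of h] unfolding g by blast
  qed
  have "rat_inv \<sigma> = g"
    unfolding rat_inv_def
    by (rule the_equality) (use 1 2 uniq in \<open>unfold t_def, blast+\<close>)
  then show "rat_inv \<sigma> = to_fract [:-b, d:] / to_fract [:a, -c:]"
    and "\<sigma> \<circ>\<^sub>r rat_inv \<sigma> = rat_X" and "rat_inv \<sigma> \<circ>\<^sub>r \<sigma> = rat_X"
    using 1 2 by (simp_all add: g_def t_def)
qed

lemma rat_degree_0_imp_const: "rat_degree g = 0 \<Longrightarrow> \<exists>c. g = rat_const c"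
proof -
  assume "rat_degree g = 0"
  then have "Polynomial.degree (rat_num g) = 0" "Polynomial.degree (rat_den g) = 0"
    by (auto simp: rat_degree_def)
  then obtain a b where "rat_num g = [:a:]" "rat_den g = [:b:]"
    by (meson degree_eq_zeroE)
  then have "g = rat_const (a / b)"
    using rat_num_den_quotient[of g] by (simp add: rat_const_divide)
  then show ?thesis by blast
qed

subsection \<open>Fields of iterated preimages\<close>

lemma algebraic_closure_imp_closed:
  assumes "algebraic_closure R K"
  shows "algebraically_closed R"
proof -
  interpret algebraic_closure R K by (rule assms)
  show ?thesis by (rule algebraically_closed_axioms)
qed

lemma adjoin_points_subfield: "subfield (adjoin_points F S) (\<Omega> :: 'a::field ring)"
  unfolding adjoin_points_def by (rule field.generate_field_is_subfield[OF Omega_field]) simp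

lemma adjoin_points_incl:
  fixes F :: "'a::field set"
  shows "F \<subseteq> adjoin_points F S" "S \<subseteq> proj_points (adjoin_points F S)"
proof -
  show "F \<subseteq> adjoin_points F S"
    by (auto simp: adjoin_points_def intro: generate_field.incl)
  show "S \<subseteq> proj_points (adjoin_points F S)"
  proof
    fix z assume "z \<in> S"
    then show "z \<in> proj_points (adjoin_points F S)"
      by (cases z) (auto simp: adjoin_points_def intro: generate_field.incl)
  qed
qed

lemma adjoin_points_minimal:
  fixes L :: "'a::field set"
  assumes "subfield L \<Omega>" "F \<subseteq> L" "S \<subseteq> proj_points L"
  shows "adjoin_points F S \<subseteq> L"
  unfolding adjoin_points_def
  using assms by (intro field.generate_field_min_subfield1[OF Omega_field]) auto

text \<open>Any two elements already lie in a common member of the chain.\<close>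

lemma subring_Union_chain:
  fixes E :: "nat \<Rightarrow> 'a::field set"
  assumes "\<And>n. subfield (E n) \<Omega>" "\<And>n. E n \<subseteq> E (Suc n)"
  shows "subring (\<Union>n. E n) \<Omega>"
proof -
  have mono: "mono E" using assms(2) by (rule incseq_SucI)
  have common: "\<exists>n. x \<in> E n \<and> y \<in> E n" if xy: "x \<in> (\<Union>n. E n)" "y \<in> (\<Union>n. E n)" for x y
  proof -
    obtain i j where "x \<in> E i" "y \<in> E j" using xy by blast
    then have "x \<in> E (max i j)" "y \<in> E (max i j)"
      using monoD[OF mono, of i "max i j"] monoD[OF mono, of j "max i j"] by auto
    then show ?thesis by blast
  qed
  show ?thesis
  proof (rule Omega.subringI)
    show "\<one>\<^bsub>\<Omega>\<^esub> \<in> (\<Union>n. E n)"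
      using subfield_closed(2)[OF assms(1)] by simp
  next
    fix x assume "x \<in> (\<Union>n. E n)"
    then show "\<ominus>\<^bsub>\<Omega>\<^esub> x \<in> (\<Union>n. E n)"
      using subfield_closed(5)[OF assms(1)] by auto
  next
    fix x y assume "x \<in> (\<Union>n. E n)" "y \<in> (\<Union>n. E n)"
    then obtain n where "x \<in> E n" "y \<in> E n" using common by blast
    then have "x * y \<in> E n" "x + y \<in> E n"
      using subfield_closed(3,4)[OF assms(1)[of n]] by auto
    then show "x \<otimes>\<^bsub>\<Omega>\<^esub> y \<in> (\<Union>n. E n)" "x \<oplus>\<^bsub>\<Omega>\<^esub> y \<in> (\<Union>n. E n)"
      by auto
  qed simp
qed

lemma ratfuns_mono:
  assumes "F \<subseteq> F'"
  shows "ratfuns F \<subseteq> ratfuns F'"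
proof
  fix f assume "f \<in> ratfuns F"
  then obtain p q where pq: "f = to_fract p / to_fract q" "q \<noteq> 0" "poly_over F p" "poly_over F q"
    unfolding ratfuns_iff by blast
  then have "poly_over F' p" "poly_over F' q"
    using assms by (auto simp: poly_over_def)
  with pq show "f \<in> ratfuns F'"
    unfolding ratfuns_iff by blast
qed

text \<open>By surjectivity a point \<open>z\<close> of level n is the image of some
  \<open>w\<close> of level n + 1; as \<phi> is defined over \<open>K\<close>, \<open>z\<close> is
  rational over any extension of \<open>K\<close> over which \<open>w\<close> is.\<close>

lemma preimage_field_mono:
  fixes K :: "'a::field set"
  assumes \<phi>: "\<phi> \<in> ratfuns K" and surj: "surj (rat_eval \<phi>)"
  shows "preimage_field K \<phi> \<beta> n \<subseteq> preimage_field K \<phi> \<beta> (Suc n)"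
proof -
  define F where "F = preimage_field K \<phi> \<beta> (Suc n)"
  have F: "subfield F \<Omega>"
    unfolding F_def preimage_field_def by (rule adjoin_points_subfield)
  have "K \<subseteq> F"
    unfolding F_def preimage_field_def
    by (rule subset_trans[OF adjoin_points_incl(1) adjoin_points_incl(1)])
  then have \<phi>F: "\<phi> \<in> ratfuns F"
    using \<phi> ratfuns_mono by blast
  have pre: "z \<in> proj_points F" if z: "(rat_eval \<phi> ^^ n) z = \<beta>" for z
  proof -
    obtain w where w: "z = rat_eval \<phi> w" by (rule surjE[OF surj])
    then have "(rat_eval \<phi> ^^ Suc n) w = \<beta>" using z by (simp only: funpow_Suc_right o_apply)
    then have "w \<in> proj_points F"
      unfolding F_def preimage_field_def by (intro subsetD[OF adjoin_points_incl(2)] CollectI)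
    then show ?thesis using rat_eval_proj_points[OF F \<phi>F] w by simp
  qed
  show ?thesis
    unfolding F_def[symmetric] preimage_field_def[of K \<phi> \<beta> n]
  proof (rule adjoin_points_minimal[OF F])
    show "adjoin_points K {\<beta>} \<subseteq> F"
      unfolding F_def preimage_field_def by (rule adjoin_points_incl(1))
  qed (use pre in blast)
qed

theorem theorem12p3:
  fixes k K :: "'a::field set"
    and \<phi> \<sigma> :: "'a poly fract"
    and \<beta> :: "'a proj_line"
  assumes "algebraically_closed (\<Omega>\<lparr>carrier := k\<rparr>)"
    and "function_field_1 k K"
    and "algebraic_closure \<Omega> K"
    and "\<phi> \<in> ratfuns K"
    and "rat_degree \<phi> \<ge> 2"
    and "rat_degree \<sigma> = 1"
    and "\<sigma> \<circ>\<^sub>r \<phi> \<circ>\<^sub>r rat_inv \<sigma> \<in> ratfuns k"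
    and "rat_eval \<sigma> \<beta> \<in> Fin ` k"
  shows "finite (carrier (G_infinity K \<phi> \<beta>))"
proof -
  have k: "subfield k \<Omega>" and K: "subfield K \<Omega>" and "k \<subseteq> K"
    using assms(2) by (auto simp: function_field_1_def)
  have closed: "algebraically_closed (\<Omega> :: 'a ring)"
    using assms(3) by (rule algebraic_closure_imp_closed)
  have alg: "(Omega.algebraic over K) x" for x
    using algebraic_closure.algebraic_extension[OF assms(3), of x] by simp
  obtain a b c d where coeffs: "rat_num \<sigma> = [:b, a:]" "rat_den \<sigma> = [:d, c:]" "a * d - b * c \<noteq> 0"
    by (rule degree_one_coeffs[OF assms(6)])
  note inv = rat_inv_degree_one[OF coeffs]
  define \<psi> where "\<psi> = \<sigma> \<circ>\<^sub>r \<phi> \<circ>\<^sub>r rat_inv \<sigma>"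
  \<comment> \<open>Were the inverse constant, so would be its composite with \<sigma>, which is X.
    Nonconstancy is what allows evaluating compositions with it.\<close>
  have deg_inv: "rat_degree (rat_inv \<sigma>) > 0"
  proof (rule ccontr)
    assume "\<not> rat_degree (rat_inv \<sigma>) > 0"
    then obtain e where e: "rat_inv \<sigma> = rat_const e"
      using rat_degree_0_imp_const by blast
    have "\<exists>e'. \<sigma> \<circ>\<^sub>r rat_inv \<sigma> = rat_const e'"
      unfolding e rat_compose_def poly_at_const rat_const_divide[symmetric] by blast
    then show False using inv(2) rat_X_not_const by metis
  qed
  have inv_eval: "rat_eval (rat_inv \<sigma>) (rat_eval \<sigma> z) = z" for z
    using rat_eval_compose[OF poly_at_nonzero[OF closed _ rat_den_nonzero], of \<sigma> "rat_inv \<sigma>" z] assms(6) inv(3)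
    by simp
  \<comment> \<open>\<open>\<circ>\<^sub>r\<close> associates to the left, so the inverse is
    evaluated first, turning \<sigma>(z) back into z, and then \<sigma> after \<phi>.\<close>
  have \<psi>_eval: "rat_eval \<psi> (rat_eval \<sigma> z) = rat_eval \<sigma> (rat_eval \<phi> z)" for z
    unfolding \<psi>_def
    using rat_eval_compose[OF poly_at_nonzero[OF closed deg_inv rat_den_nonzero]]
      rat_eval_compose[OF poly_at_nonzero[OF closed _ rat_den_nonzero], of \<phi> \<sigma>] assms(5)
    by (simp add: inv_eval)
  \<comment> \<open>Surjectivity of \<psi>, required for pulling back \<open>k\<close>-rational
    points, is transported from \<phi> and \<sigma> along \<open>\<psi>_eval\<close>.\<close>
  have surj: "surj (rat_eval \<phi>)" "surj (rat_eval \<sigma>)"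
    using surj_rat_eval[OF closed] assms(5,6) by auto
  have "surj (rat_eval \<psi>)"
    unfolding surj_def
  proof
    fix y
    obtain z where z: "y = rat_eval \<sigma> z" by (rule surjE[OF surj(2)])
    obtain w where "z = rat_eval \<phi> w" by (rule surjE[OF surj(1)])
    with z have "y = rat_eval \<psi> (rat_eval \<sigma> w)" by (simp only: \<psi>_eval)
    then show "\<exists>x. y = rat_eval \<psi> x" by blast
  qed
  note pullback = rat_eval_proj_points_rev[OF k assms(1,7)[folded \<psi>_def] this]
  have pre: "rat_eval \<sigma> z \<in> proj_points k" if "(rat_eval \<phi> ^^ n) z = \<beta>" for n z
    using that
  proof (induction n arbitrary: z)
    case 0
    then show ?case using assms(8) by (auto simp: proj_points_def)
  next
    case (Suc n)
    then have "rat_eval \<sigma> (rat_eval \<phi> z) \<in> proj_points k" by (simp only: funpow_Suc_right o_apply)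
    then show ?case using pullback \<psi>_eval by simp
  qed
  define L where "L = Omega.finite_extension K [a, b, c, d]"
  have L: "subfield L \<Omega>" "Omega.finite_dimension K L" "K \<subseteq> L" "set [a, b, c, d] \<subseteq> L"
    unfolding L_def
    using Omega.finite_extension_is_subfield[OF K, of "[a, b, c, d]"]
      Omega.finite_extension_finite_dimension[OF K, of "[a, b, c, d]"]
      Omega.finite_extension_incl[of K "[a, b, c, d]"]
      Omega.finite_extension_mem[OF subfieldE(1)[OF K], of "[a, b, c, d]"] alg
    by (auto simp del: Omega.finite_extension.simps)
  \<comment> \<open>Points return from the \<sigma>-coordinate through the inverse, whose
    coefficients are those of \<sigma> up to sign.\<close>
  have "rat_inv \<sigma> \<in> ratfuns L"
    unfolding ratfuns_iff inv(1)
  proof (intro exI conjI)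
    show "[:a, -c:] \<noteq> 0" using coeffs(3) by auto
    show "poly_over L [:-b, d:]" "poly_over L [:a, -c:]"
      using L subfield_closed[OF L(1)] by (simp_all add: poly_over_pCons_iff)
  qed (rule refl)
  have pre_L: "z \<in> proj_points L" if "(rat_eval \<phi> ^^ n) z = \<beta>" for n z
  proof -
    have "rat_eval \<sigma> z \<in> proj_points L"
      using pre[OF that] \<open>k \<subseteq> K\<close> \<open>K \<subseteq> L\<close> by (auto simp: proj_points_def)
    then show ?thesis
      using rat_eval_proj_points[OF L(1) \<open>rat_inv \<sigma> \<in> ratfuns L\<close>] inv_eval by metis
  qed
  define E where "E = (\<Union>n. preimage_field K \<phi> \<beta> n)"
  have base: "K \<subseteq> adjoin_points K {\<beta>}" by (rule adjoin_points_incl)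
  \<comment> \<open>For n = 0 the only preimage is \<beta> itself, so \<beta> is rational over
    \<open>L\<close>.\<close>
  have base_L: "adjoin_points K {\<beta>} \<subseteq> L"
    using pre_L[of 0 \<beta>] by (intro adjoin_points_minimal L) auto
  have "preimage_field K \<phi> \<beta> n \<subseteq> L" for n
    unfolding preimage_field_def
    by (rule adjoin_points_minimal[OF L(1) base_L]) (use pre_L in blast)
  then have "E \<subseteq> L" by (auto simp: E_def)
  have "K \<subseteq> E"
    using base adjoin_points_incl(1) unfolding E_def preimage_field_def by blast
  have "subring E \<Omega>"
    unfolding E_def
  proof (rule subring_Union_chain)
    show "subfield (preimage_field K \<phi> \<beta> n) \<Omega>" for n
      unfolding preimage_field_def by (rule adjoin_points_subfield)
  qed (rule preimage_field_mono[OF assms(4) surj(1)])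
  then have "finite (carrier (galois_group E K))"
    using finite_galois_group[OF K _ \<open>K \<subseteq> E\<close> \<open>E \<subseteq> L\<close> L(2) subfieldE(1)[OF L(1)]] by blast
  \<comment> \<open>Fixing K(\<beta>) implies fixing K, so the count over K, where \<open>L\<close>
    is known to be finite-dimensional, bounds the group.\<close>
  moreover have "carrier (G_infinity K \<phi> \<beta>) \<subseteq> carrier (galois_group E K)"
    using base by (auto simp: G_infinity_def galois_group_def E_def)
  ultimately show ?thesis by (rule finite_subset[rotated])
qed

end
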